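(* Let $u_h:[0,\infty)\to X_h$ be the solution of the semidiscrete problem $$(u_h'',v)+\beta\,a_h(u_h',v)+\alpha(u_h',v)+a_h(u_h,v)=0\quad\forall v\in X_h,\qquad u_h(0)=u_{0h},\ u_h'(0)=u_{1h},$$ with $u_{0h},u_{1h}\in X_h$. For $k\in\{1,2,3,\dots\}$ let $E_h^{(k)}(u_h)(t)=\frac12\left(\|u_h^{(k)}(t)\|^2+|u_h^{(k-1)}(t)|_1^2\right)$, where $u_h^{(k)}$ is the $k$-th time derivative ($u_h^{(0)}=u_h$). Let $0<\delta\le\min\left(\frac{\alpha+\beta\lambda_1}{2},\frac{\lambda_1}{\alpha+\beta\lambda_1}\right)$ and $k\in\{1,2,3,\dots\}$. Then the following hold for all $t\ge0$. (i) If $0<\delta<\min\left(\frac{\alpha+\beta\lambda_1}{2},\frac{\lambda_1}{\alpha+\beta\lambda_1}\right)$ or $0<\delta=\frac{\alpha+\beta\lambda_1}{2}$, then there is a constant $C=C(\alpha,\beta,\lambda_1)>0$, independent of $h$, $t$ and the initial data, such that $$E_h^{(k)}(u_h)(t)\le C\,e^{-2\delta t}E_h^{(k)}(u_h)(0).$$ (ii) If $0<\delta=\frac{\lambda_1}{\alpha+\beta\lambda_1}$, then there is a constant $C>0$, independent of $h$, $t$ and the initial data, such that $$\|u_h^{(k)}(t)\|^2\le C\,e^{-2\delta t}E_h^{(k)}(u_h)(0).$$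
   Context: $\Omega\subset\mathbb{R}^d$ is a bounded domain; $\|\cdot\|$, $(\cdot,\cdot)$ are the $L^2(\Omega)$ norm and inner product; $A=-\Delta$ with domain $H^2(\Omega)\cap H_0^1(\Omega)$, $\lambda_1>0$ its smallest eigenvalue, so $\|v\|^2\le\lambda_1^{-1}\|A^{1/2}v\|^2$ for $v\in H_0^1(\Omega)$; $|v|_1=\|A^{1/2}v\|=\|\nabla v\|$. The damping parameters are constants with ($\alpha>0$, $\beta\ge0$) or ($\alpha\ge0$, $\beta>0$). $X_h\subset H_0^1(\Omega)$ is a finite-dimensional (finite element) subspace associated with a shape regular triangulation of $\bar\Omega$ of mesh size $h$, satisfying $\inf_{\psi_h\in X_h}\{\|\psi-\psi_h\|+h\|\psi-\psi_h\|_1\}\le Ch^2\|\psi\|_2$ for all $\psi\in H^2(\Omega)\cap H_0^1(\Omega)$. The bilinear form is $a_h(w_h,\chi_h)=(A^{1/2}w_h,A^{1/2}\chi_h)=(A_hw_h,\chi_h)$ for $w_h,\chi_h\in X_h$, which defines $A_h:X_h\to X_h$; so $\|A_h^{1/2}\chi_h\|=|\chi_h|_1$. Primes denote time derivatives. *)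

theory Defs
  imports "HOL-Analysis.Analysis"
begin

section \<open>The Hilbert space of square-integrable functions\<close>

definition square_integrable :: "('a::euclidean_space \<Rightarrow> real) \<Rightarrow> bool" where
  "square_integrable f \<longleftrightarrow> f \<in> borel_measurable lborel \<and> integrable lborel (\<lambda>x. (f x)\<^sup>2)"

definition L2_eq :: "('a::euclidean_space \<Rightarrow> real) \<Rightarrow> ('a \<Rightarrow> real) \<Rightarrow> bool" where
  "L2_eq f g \<longleftrightarrow> square_integrable f \<and> square_integrable g \<and> (AE x in lborel. f x = g x)"

lemma square_integrable_zero: "square_integrable (\<lambda>x. 0)"
  by (simp add: square_integrable_def)

lemma square_integrable_mult:
  assumes "square_integrable f" "square_integrable g"
  shows "integrable lborel (\<lambda>x. f x * g x)"
proof (rule Bochner_Integration.integrable_bound)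
  show "integrable lborel (\<lambda>x. (f x)\<^sup>2 + (g x)\<^sup>2)"
    using assms by (auto simp: square_integrable_def)
  show "(\<lambda>x. f x * g x) \<in> borel_measurable lborel"
    using assms by (auto simp: square_integrable_def)
  have "\<bar>f x * g x\<bar> \<le> (f x)\<^sup>2 + (g x)\<^sup>2" for x
  proof -
    have "0 \<le> (\<bar>f x\<bar> - \<bar>g x\<bar>)\<^sup>2" by simp
    then have "2 * \<bar>f x * g x\<bar> \<le> (f x)\<^sup>2 + (g x)\<^sup>2"
      by (simp add: power2_diff abs_mult mult.assoc)
    then show ?thesis using abs_ge_zero[of "f x * g x"] by linarith
  qed
  then show "AE x in lborel. norm (f x * g x) \<le> norm ((f x)\<^sup>2 + (g x)\<^sup>2)"
    by simp
qed

lemma square_integrable_add: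
  assumes "square_integrable f" "square_integrable g"
  shows "square_integrable (\<lambda>x. f x + g x)"
proof -
  have "integrable lborel (\<lambda>x. (f x)\<^sup>2 + (g x)\<^sup>2 + 2 * (f x * g x))"
    using assms square_integrable_mult[OF assms]
    by (auto simp: square_integrable_def)
  then have "integrable lborel (\<lambda>x. (f x + g x)\<^sup>2)"
    by (simp add: power2_sum mult.assoc)
  then show ?thesis using assms by (auto simp: square_integrable_def)
qed

lemma square_integrable_scale:
  assumes "square_integrable f" shows "square_integrable (\<lambda>x. c * f x)"
  using assms by (auto simp: square_integrable_def power_mult_distrib)

text \<open>The space is over all of \<open>\<real>\<^sup>d\<close>; functions on \<open>\<Omega>\<close> are extended by zero, see
  \<open>L2_on\<close> below. The morphism \<open>L2_class\<close> is meaningful on square-integrable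
  functions only.\<close>

quotient_type (overloaded) 'a L2 = "'a::euclidean_space \<Rightarrow> real" / partial: L2_eq
  morphisms L2_rep L2_class
proof (rule part_equivpI)
  show "\<exists>f::'a \<Rightarrow> real. L2_eq f f"
    by (rule exI[of _ "\<lambda>x. 0"]) (simp add: L2_eq_def square_integrable_zero)
  show "symp (L2_eq :: ('a \<Rightarrow> real) \<Rightarrow> _)" by (auto simp: symp_def L2_eq_def)
  show "transp (L2_eq :: ('a \<Rightarrow> real) \<Rightarrow> _)"
    by (auto simp: transp_def L2_eq_def)
qed

instantiation L2 :: (euclidean_space) real_inner
begin

lift_definition zero_L2 :: "'a L2" is "\<lambda>x. 0"
  by (simp add: L2_eq_def square_integrable_zero)

lift_definition plus_L2 :: "'a L2 \<Rightarrow> 'a L2 \<Rightarrow> 'a L2" is "\<lambda>f g x. f x + g x"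
  by (auto simp: L2_eq_def square_integrable_add)

lift_definition scaleR_L2 :: "real \<Rightarrow> 'a L2 \<Rightarrow> 'a L2" is "\<lambda>c f x. c * f x"
  by (auto simp: L2_eq_def square_integrable_scale)

lift_definition uminus_L2 :: "'a L2 \<Rightarrow> 'a L2" is "\<lambda>f x. - f x"
  using square_integrable_scale[of _ "-1"] by (auto simp: L2_eq_def)

lift_definition minus_L2 :: "'a L2 \<Rightarrow> 'a L2 \<Rightarrow> 'a L2" is "\<lambda>f g x. f x - g x"
  using square_integrable_add[OF _ square_integrable_scale[of _ "-1"]]
  by (auto simp: L2_eq_def)

lift_definition inner_L2 :: "'a L2 \<Rightarrow> 'a L2 \<Rightarrow> real" is "\<lambda>f g. \<integral>x. f x * g x \<partial>lborel"
  by (rule integral_cong_AE) (auto simp: L2_eq_def square_integrable_def)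

definition norm_L2 :: "'a L2 \<Rightarrow> real" where "norm_L2 v = sqrt (inner v v)"
definition dist_L2 :: "'a L2 \<Rightarrow> 'a L2 \<Rightarrow> real" where "dist_L2 v w = norm (v - w)"
definition sgn_L2 :: "'a L2 \<Rightarrow> 'a L2" where "sgn_L2 v = inverse (norm v) *\<^sub>R v"
definition uniformity_L2 :: "('a L2 \<times> 'a L2) filter" where
  "uniformity_L2 = (INF e\<in>{0<..}. principal {(x, y). dist x y < e})"
definition open_L2 :: "'a L2 set \<Rightarrow> bool" where
  "open_L2 U \<longleftrightarrow> (\<forall>x\<in>U. \<forall>\<^sub>F (x', y) in uniformity. x' = x \<longrightarrow> y \<in> U)"

instance
proof
  fix u v w :: "'a L2" and r s :: real
  show "u + v + w = u + (v + w)"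
    by transfer (auto simp: L2_eq_def square_integrable_add add.assoc)
  show "u + v = v + u"
    by transfer (auto simp: L2_eq_def square_integrable_add add.commute)
  show "0 + u = u" by transfer (auto simp: L2_eq_def)
  show "- u + u = 0"
    by transfer (auto simp: L2_eq_def square_integrable_zero)
  show "u - v = u + - v"
    by transfer (use square_integrable_add[OF _ square_integrable_scale[of _ "-1"]]
      in \<open>auto simp: L2_eq_def\<close>)
  show "r *\<^sub>R (u + v) = r *\<^sub>R u + r *\<^sub>R v"
    by transfer (auto simp: L2_eq_def square_integrable_add square_integrable_scale
        distrib_left)
  show "(r + s) *\<^sub>R u = r *\<^sub>R u + s *\<^sub>R u"
    by transfer (auto simp: L2_eq_def square_integrable_add square_integrable_scale
        distrib_right)
  show "r *\<^sub>R s *\<^sub>R u = (r * s) *\<^sub>R u"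
    by transfer (auto simp: L2_eq_def square_integrable_scale mult.assoc)
  show "1 *\<^sub>R u = u" by transfer (auto simp: L2_eq_def)
  show "dist u v = norm (u - v)" by (rule dist_L2_def)
  show "sgn u = inverse (norm u) *\<^sub>R u" by (rule sgn_L2_def)
  show "(uniformity :: ('a L2 \<times> 'a L2) filter)
      = (INF e\<in>{0<..}. principal {(x, y). dist x y < e})"
    by (rule uniformity_L2_def)
  show "open U \<longleftrightarrow> (\<forall>x\<in>U. \<forall>\<^sub>F (x', y) in uniformity. x' = x \<longrightarrow> y \<in> U)" for U :: "'a L2 set"
    by (rule open_L2_def)
  show "inner u v = inner v u" by transfer (simp add: mult.commute)
  show "inner (u + v) w = inner u w + inner v w"
    by transfer (simp add: L2_eq_def distrib_right square_integrable_mult)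
  show "inner (r *\<^sub>R u) v = r * inner u v"
    by transfer (simp add: mult.assoc)
  show "0 \<le> inner u u" by transfer simp
  show "inner u u = 0 \<longleftrightarrow> u = 0"
  proof transfer
    fix f :: "'a \<Rightarrow> real" assume "L2_eq f f"
    then have sq: "square_integrable f" by (simp add: L2_eq_def)
    have "(\<integral>x. f x * f x \<partial>lborel) = 0 \<longleftrightarrow> (AE x in lborel. f x * f x = 0)"
      by (rule integral_nonneg_eq_0_iff_AE) (auto simp: square_integrable_mult sq)
    then show "((\<integral>x. f x * f x \<partial>lborel) = 0) = L2_eq f (\<lambda>x. 0)"
      by (simp add: L2_eq_def sq square_integrable_zero)
  qed
  show "norm u = sqrt (inner u u)" by (rule norm_L2_def)
qed

end

lift_definition vanishes_off :: "'a::euclidean_space set \<Rightarrow> 'a L2 \<Rightarrow> bool"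
  is "\<lambda>\<Omega> f. AE x in lborel. x \<notin> \<Omega> \<longrightarrow> f x = 0"
  by (auto simp: L2_eq_def elim!: eventually_elim2)

definition L2_on :: "'a::euclidean_space set \<Rightarrow> 'a L2 set" where
  "L2_on \<Omega> = {v. vanishes_off \<Omega> v}"

section \<open>Test functions, weak derivatives and Sobolev spaces\<close>

coinductive smooth :: "('a::euclidean_space \<Rightarrow> real) \<Rightarrow> bool" where
  "\<lbrakk>\<And>x. (f has_derivative (\<lambda>h. inner (g x) h)) (at x);
    \<And>b. b \<in> Basis \<Longrightarrow> smooth (\<lambda>x. inner (g x) b)\<rbrakk> \<Longrightarrow> smooth f"

definition test_fun :: "'a::euclidean_space set \<Rightarrow> ('a \<Rightarrow> real) \<Rightarrow> bool" where
  "test_fun \<Omega> \<phi> \<longleftrightarrow> smooth \<phi> \<and> compact (closure {x. \<phi> x \<noteq> 0}) \<and> closure {x. \<phi> x \<noteq> 0} \<subseteq> \<Omega>"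

definition pderiv_cl :: "'a::euclidean_space \<Rightarrow> ('a \<Rightarrow> real) \<Rightarrow> 'a \<Rightarrow> real" where
  "pderiv_cl b \<phi> x = frechet_derivative \<phi> (at x) b"

lemma smooth_continuous: "smooth f \<Longrightarrow> continuous_on UNIV f"
  by (erule smooth.cases)
    (auto intro!: continuous_at_imp_continuous_on has_derivative_continuous)

lemma smooth_pderiv_cl:
  assumes "smooth f" "b \<in> Basis" shows "smooth (pderiv_cl b f)"
  using assms(1)
proof cases
  case (1 g)
  have "pderiv_cl b f = (\<lambda>x. inner (g x) b)"
    using frechet_derivative_at[OF 1(1)] by (auto simp: pderiv_cl_def fun_eq_iff)
  then show ?thesis using 1(2)[OF assms(2)] by simp
qed

lemma test_fun_pderiv_cl:
  assumes "test_fun \<Omega> \<phi>" "b \<in> Basis" shows "test_fun \<Omega> (pderiv_cl b \<phi>)"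
proof -
  have "pderiv_cl b \<phi> x = 0" if x: "x \<notin> closure {x. \<phi> x \<noteq> 0}" for x
  proof -
    have "(\<phi> has_derivative (\<lambda>h. 0)) (at x)"
    proof (rule has_derivative_transform_within_open)
      show "((\<lambda>x. 0) has_derivative (\<lambda>h. 0)) (at x)" by simp
      show "open (- closure {x. \<phi> x \<noteq> 0})" "x \<in> - closure {x. \<phi> x \<noteq> 0}"
        using x by auto
      show "0 = \<phi> y" if "y \<in> - closure {x. \<phi> x \<noteq> 0}" for y
        using that closure_subset[of "{x. \<phi> x \<noteq> 0}"] by auto
    qed
    from frechet_derivative_at[OF this] have "frechet_derivative \<phi> (at x) = (\<lambda>h. 0)" by (rule sym)
    then show ?thesis by (simp add: pderiv_cl_def)
  qed
  then have sub: "closure {x. pderiv_cl b \<phi> x \<noteq> 0} \<subseteq> closure {x. \<phi> x \<noteq> 0}"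
    by (intro closure_minimal) auto
  moreover have "compact (closure {x. pderiv_cl b \<phi> x \<noteq> 0})"
    using assms(1) sub by (metis closed_closure compact_Int_closed inf.absorb2 test_fun_def)
  ultimately show ?thesis
    using assms smooth_pderiv_cl by (auto simp: test_fun_def)
qed

lemma test_fun_square_integrable:
  assumes "test_fun \<Omega> \<phi>" shows "square_integrable \<phi>"
proof -
  let ?K = "closure {x. \<phi> x \<noteq> 0}"
  have c: "continuous_on UNIV \<phi>" using assms smooth_continuous by (auto simp: test_fun_def)
  have "integrable lborel (\<lambda>x. indicator ?K x *\<^sub>R (\<phi> x)\<^sup>2)"
    using assms c continuous_on_subset
    by (intro borel_integrable_compact) (auto simp: test_fun_def intro!: continuous_intros)
  moreover have "(\<lambda>x. indicator ?K x *\<^sub>R (\<phi> x)\<^sup>2) = (\<lambda>x. (\<phi> x)\<^sup>2)"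
    using closure_subset[of "{x. \<phi> x \<noteq> 0}"] by (auto simp: fun_eq_iff indicator_def)
  ultimately show ?thesis
    using c by (auto simp: square_integrable_def intro!: borel_measurable_continuous_onI)
qed

text \<open>The identity \<open>\<integral>\<^bsub>\<Omega>\<^esub> v \<partial>\<^bsub>b\<^esub>\<phi> = - \<integral>\<^bsub>\<Omega>\<^esub> g \<phi>\<close>; the classes of \<open>\<partial>\<^bsub>b\<^esub>\<phi>\<close> and \<open>\<phi>\<close>
  are meaningful by the two preceding lemmas.\<close>

definition weak_pderiv :: "'a::euclidean_space set \<Rightarrow> 'a \<Rightarrow> 'a L2 \<Rightarrow> 'a L2 \<Rightarrow> bool" where
  "weak_pderiv \<Omega> b v g \<longleftrightarrow> v \<in> L2_on \<Omega> \<and> g \<in> L2_on \<Omega> \<and>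
     (\<forall>\<phi>. test_fun \<Omega> \<phi> \<longrightarrow> inner v (L2_class (pderiv_cl b \<phi>)) = - inner g (L2_class \<phi>))"

definition H1 :: "'a::euclidean_space set \<Rightarrow> 'a L2 set" where
  "H1 \<Omega> = {v \<in> L2_on \<Omega>. \<forall>b\<in>Basis. \<exists>g. weak_pderiv \<Omega> b v g}"

definition pd :: "'a::euclidean_space set \<Rightarrow> 'a \<Rightarrow> 'a L2 \<Rightarrow> 'a L2" where
  "pd \<Omega> b v = (THE g. weak_pderiv \<Omega> b v g)"

definition H2 :: "'a::euclidean_space set \<Rightarrow> 'a L2 set" where
  "H2 \<Omega> = {v \<in> H1 \<Omega>. \<forall>b\<in>Basis. pd \<Omega> b v \<in> H1 \<Omega>}"

text \<open>\<open>grad_form \<Omega> v w = \<integral>\<^bsub>\<Omega>\<^esub> \<nabla>v \<cdot> \<nabla>w\<close>; this is \<open>(A\<^sup>1\<^sup>/\<^sup>2 v, A\<^sup>1\<^sup>/\<^sup>2 w)\<close> on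
  \<open>H10 \<Omega>\<close> and its restriction to a discrete space is the form \<open>a\<^sub>h\<close>.\<close>

definition grad_form :: "'a::euclidean_space set \<Rightarrow> 'a L2 \<Rightarrow> 'a L2 \<Rightarrow> real" where
  "grad_form \<Omega> v w = (\<Sum>b\<in>Basis. inner (pd \<Omega> b v) (pd \<Omega> b w))"

definition H1_seminorm :: "'a::euclidean_space set \<Rightarrow> 'a L2 \<Rightarrow> real" where
  "H1_seminorm \<Omega> v = sqrt (grad_form \<Omega> v v)"

definition H1_norm :: "'a::euclidean_space set \<Rightarrow> 'a L2 \<Rightarrow> real" where
  "H1_norm \<Omega> v = sqrt ((norm v)\<^sup>2 + (H1_seminorm \<Omega> v)\<^sup>2)"

definition H2_norm :: "'a::euclidean_space set \<Rightarrow> 'a L2 \<Rightarrow> real" where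
  "H2_norm \<Omega> v = sqrt ((norm v)\<^sup>2 + (H1_seminorm \<Omega> v)\<^sup>2
     + (\<Sum>b\<in>Basis. (H1_seminorm \<Omega> (pd \<Omega> b v))\<^sup>2))"

definition H10 :: "'a::euclidean_space set \<Rightarrow> 'a L2 set" where
  "H10 \<Omega> = {v \<in> H1 \<Omega>. \<forall>\<epsilon>>0. \<exists>\<phi>. test_fun \<Omega> \<phi> \<and> H1_norm \<Omega> (v - L2_class \<phi>) < \<epsilon>}"

section \<open>The Dirichlet Laplacian and its smallest eigenvalue\<close>

definition dom_A :: "'a::euclidean_space set \<Rightarrow> 'a L2 set" where
  "dom_A \<Omega> = H2 \<Omega> \<inter> H10 \<Omega>"

definition op_A :: "'a::euclidean_space set \<Rightarrow> 'a L2 \<Rightarrow> 'a L2" where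
  "op_A \<Omega> v = - (\<Sum>b\<in>Basis. pd \<Omega> b (pd \<Omega> b v))"

definition eigenvalue_A :: "'a::euclidean_space set \<Rightarrow> real \<Rightarrow> bool" where
  "eigenvalue_A \<Omega> \<mu> \<longleftrightarrow> (\<exists>v\<in>dom_A \<Omega>. v \<noteq> 0 \<and> op_A \<Omega> v = \<mu> *\<^sub>R v)"

text \<open>The Poincare inequality is kept as a separate clause because for a general bounded domain
  (e.g. one with reentrant corners) \<open>-\<Delta>\<close> on \<open>H\<^sup>2 \<inter> H\<^sub>0\<^sup>1\<close> need not be self-adjoint, and then its
  smallest eigenvalue need not be the optimal constant.\<close>

definition dirichlet_setting :: "'a::euclidean_space set \<Rightarrow> real \<Rightarrow> bool" where
  "dirichlet_setting \<Omega> lam1 \<longleftrightarrow>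
     open \<Omega> \<and> connected \<Omega> \<and> \<Omega> \<noteq> {} \<and> bounded \<Omega> \<and>
     lam1 > 0 \<and> eigenvalue_A \<Omega> lam1 \<and> (\<forall>\<mu>. eigenvalue_A \<Omega> \<mu> \<longrightarrow> lam1 \<le> \<mu>) \<and>
     (\<forall>v\<in>H10 \<Omega>. (norm v)\<^sup>2 \<le> inverse lam1 * (H1_seminorm \<Omega> v)\<^sup>2)"

section \<open>Finite element spaces\<close>

text \<open>A family of simplicial meshes \<open>T h\<close> of \<open>closure \<Omega>\<close> with mesh sizes \<open>h \<in> H\<close>. Shape
  regularity: uniformly in \<open>h\<close>, each cell contains a ball of radius comparable to its
  diameter.\<close>

definition shape_regular_meshes ::
  "'a::euclidean_space set \<Rightarrow> real set \<Rightarrow> (real \<Rightarrow> 'a set set) \<Rightarrow> bool" where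
  "shape_regular_meshes \<Omega> H T \<longleftrightarrow> H \<subseteq> {0<..} \<and>
     (\<forall>h\<in>H. triangulation (T h) \<and> (\<forall>K\<in>T h. int DIM('a) simplex K) \<and>
        \<Union> (T h) = closure \<Omega> \<and> h = Max (diameter ` T h)) \<and>
     (\<exists>\<rho>>0. \<forall>h\<in>H. \<forall>K\<in>T h. \<exists>x. cball x (\<rho> * diameter K) \<subseteq> K)"

text \<open>The local shape functions on the cells are left arbitrary, so that the only properties of
  the discrete spaces are conformity, finite dimension and the approximation property.\<close>

definition finite_element_spaces ::
  "'a::euclidean_space set \<Rightarrow> real set \<Rightarrow> (real \<Rightarrow> 'a set set) \<Rightarrow> (real \<Rightarrow> 'a L2 set) \<Rightarrow> bool" where
  "finite_element_spaces \<Omega> H T X \<longleftrightarrow> shape_regular_meshes \<Omega> H T \<and>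
     (\<forall>h\<in>H. X h \<subseteq> H10 \<Omega> \<and> (\<exists>B. finite B \<and> X h = span B)) \<and>
     (\<exists>C. \<forall>h\<in>H. \<forall>\<psi>\<in>H2 \<Omega> \<inter> H10 \<Omega>.
        (INF \<eta>\<in>X h. norm (\<psi> - \<eta>) + h * H1_norm \<Omega> (\<psi> - \<eta>)) \<le> C * h\<^sup>2 * H2_norm \<Omega> \<psi>)"

section \<open>The semidiscrete problem\<close>

text \<open>Time derivatives on \<open>[0,\<infinity>)\<close>, one-sided at \<open>0\<close>.\<close>

definition time_deriv :: "(real \<Rightarrow> 'b::real_normed_vector) \<Rightarrow> real \<Rightarrow> 'b" where
  "time_deriv u t = vector_derivative u (at t within {0..})"

definition semidiscrete_solution ::
  "'a::euclidean_space set \<Rightarrow> real \<Rightarrow> real \<Rightarrow> 'a L2 set \<Rightarrow> 'a L2 \<Rightarrow> 'a L2 \<Rightarrow> (real \<Rightarrow> 'a L2) \<Rightarrow> bool" where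
  "semidiscrete_solution \<Omega> \<alpha> \<beta> Xh u0 u1 u \<longleftrightarrow>
     (\<forall>t\<ge>0. u t \<in> Xh \<and>
        u differentiable (at t within {0..}) \<and>
        time_deriv u differentiable (at t within {0..}) \<and>
        (\<forall>v\<in>Xh. inner (time_deriv (time_deriv u) t) v + \<beta> * grad_form \<Omega> (time_deriv u t) v
            + \<alpha> * inner (time_deriv u t) v + grad_form \<Omega> (u t) v = 0)) \<and>
     u 0 = u0 \<and> time_deriv u 0 = u1"

definition energy :: "'a::euclidean_space set \<Rightarrow> nat \<Rightarrow> (real \<Rightarrow> 'a L2) \<Rightarrow> real \<Rightarrow> real" where
  "energy \<Omega> k u t = 1/2 * ((norm ((time_deriv ^^ k) u t))\<^sup>2
     + (H1_seminorm \<Omega> ((time_deriv ^^ (k - 1)) u t))\<^sup>2)"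

end

theory Submission
  imports Defs "HOL-Computational_Algebra.Polynomial"
begin

text \<open>
  Put \<open>p = u' + \<delta> u\<close>. Along a solution the shifted energy
  \<open>L = \<parallel>p\<parallel>\<^sup>2 + (1 - \<beta> \<delta>) |u|\<^sub>1\<^sup>2 + (\<delta>\<^sup>2 - \<alpha> \<delta>) \<parallel>u\<parallel>\<^sup>2\<close> satisfies
  \<open>L' + 2 \<delta> L = - 2 (\<beta> |p|\<^sub>1\<^sup>2 + (\<alpha> - 2 \<delta>) \<parallel>p\<parallel>\<^sup>2)\<close>, which is nonpositive by the Poincare
  inequality as soon as \<open>2 \<delta> \<le> \<alpha> + \<beta> \<lambda>\<^sub>1\<close>. If \<open>\<alpha> > 0\<close>, then \<open>L\<close> is equivalent to the energy, with
  constants uniform in \<open>\<delta> \<le> \<lambda>\<^sub>1 / (\<alpha> + \<beta> \<lambda>\<^sub>1)\<close>.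

  If \<open>\<alpha> = 0\<close>, then \<open>L\<close> loses control of \<open>|u|\<^sub>1\<close> as \<open>\<delta>\<close> tends to \<open>1 / \<beta>\<close>. Writing \<open>G\<close> for the inverse
  of the discrete Laplacian and \<open>r = G u' + \<beta> u - \<delta> G u\<close>, the functional
  \<open>F = |r|\<^sub>1\<^sup>2 + (1 - \<beta> \<delta>) \<parallel>u\<parallel>\<^sup>2 + \<delta>\<^sup>2 (G u, u)\<close> also decays at rate \<open>2 \<delta>\<close>, and \<open>\<beta> u\<close> is \<open>r\<close> up to
  terms bounded by \<open>L\<close>. Hence the energy bound of part (i) holds for every admissible \<open>\<delta>\<close>, and
  part (ii) follows from it. The time derivatives of a solution are again solutions, so that \<open>k = 1\<close>
  is the general case.
\<close>

section \<open>The fundamental lemma of the calculus of variations\<close>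

text \<open>The functions \<open>flat p\<close> are closed under differentiation, and so is the algebra generated by
  their compositions with affine maps; this yields smoothness by coinduction.\<close>

definition flat :: "real poly \<Rightarrow> real \<Rightarrow> real" where
  "flat p x = (if x > 0 then poly p (inverse x) * exp (- inverse x) else 0)"

lemma poly_times_exp_uminus_tendsto_0:
  fixes p :: "real poly"
  shows "((\<lambda>y. poly p y * exp (- y)) \<longlongrightarrow> 0) at_top"
proof -
  have "((\<lambda>y. \<Sum>i\<le>degree p. coeff p i * (y ^ i / exp y)) \<longlongrightarrow> (\<Sum>i\<le>degree p. coeff p i * 0)) at_top"
    by (intro tendsto_intros tendsto_power_div_exp_0)
  moreover have "(\<lambda>y. \<Sum>i\<le>degree p. coeff p i * (y ^ i / exp y)) = (\<lambda>y. poly p y * exp (- y))"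
    by (simp add: fun_eq_iff poly_altdef sum_distrib_right exp_minus divide_inverse mult.assoc)
  ultimately show ?thesis by simp
qed

lemma flat_tendsto_0: "(flat p \<longlongrightarrow> 0) (at_right 0)"
proof -
  have "((\<lambda>x. poly p (inverse x) * exp (- inverse x)) \<longlongrightarrow> 0) (at_right (0::real))"
    by (rule filterlim_compose[OF poly_times_exp_uminus_tendsto_0 filterlim_inverse_at_top_right])
  moreover have "eventually (\<lambda>x. flat p x = poly p (inverse x) * exp (- inverse x)) (at_right 0)"
    using eventually_at_right_less[of 0] by eventually_elim (simp add: flat_def)
  ultimately show ?thesis
    by (simp add: tendsto_cong)
qed

text \<open>With y = 1/x, differentiating p(y) exp(-y) in x gives y^2 (p - p')(y) exp(-y), again of
  the same shape; \<open>[:0, 0, 1:]\<close> is y^2.\<close>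

lemma flat_has_real_derivative:
  "(flat p has_real_derivative flat ([:0, 0, 1:] * (p - pderiv p)) x) (at x)"
proof -
  consider "x > 0" | "x < 0" | "x = 0" by linarith
  then show ?thesis
  proof cases
    case 1
    have "((\<lambda>x. poly p (inverse x) * exp (- inverse x)) has_real_derivative
        flat ([:0, 0, 1:] * (p - pderiv p)) x) (at x)"
      using 1
      by (auto intro!: derivative_eq_intros simp: flat_def algebra_simps power2_eq_square)
    then show ?thesis
    proof (rule has_field_derivative_transform_within_open[of _ _ _ "{0<..}"])
      show "poly p (inverse y) * exp (- inverse y) = flat p y" if "y \<in> {0<..}" for y
        using that by (simp add: flat_def)
    qed (use 1 in auto)
  next
    case 2
    have "((\<lambda>x. 0) has_real_derivative flat ([:0, 0, 1:] * (p - pderiv p)) x) (at x)"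
      using 2 by (simp add: flat_def)
    then show ?thesis
    proof (rule has_field_derivative_transform_within_open[of _ _ _ "{..<0}"])
      show "0 = flat p y" if "y \<in> {..<0}" for y
        using that by (simp add: flat_def)
    qed (use 2 in auto)
  next
    case 3
    have "((\<lambda>h. flat p h / h) \<longlongrightarrow> 0) (at_right 0)"
    proof -
      \<comment> \<open>Dividing by h multiplies the polynomial by y = 1/h, so the right-hand
        difference quotient at 0 is again a flat function and tends to 0.\<close>
      have "eventually (\<lambda>h. flat ([:0, 1:] * p) h = flat p h / h) (at_right 0)"
        using eventually_at_right_less[of 0]
        by eventually_elim (simp add: flat_def divide_inverse)
      then show ?thesis by (rule Lim_transform_eventually[OF flat_tendsto_0])
    qed
    moreover have "((\<lambda>h. flat p h / h) \<longlongrightarrow> 0) (at_left 0)"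
    proof -
      have "eventually (\<lambda>h. flat p h / h = 0) (at_left 0)"
        by (auto simp: eventually_at_filter flat_def)
      then show ?thesis by (rule tendsto_eventually)
    qed
    ultimately have "((\<lambda>h. flat p h / h) \<longlongrightarrow> 0) (at 0)"
      by (simp add: filterlim_at_split)
    then show ?thesis
      using 3 by (simp add: DERIV_def flat_def)
  qed
qed

inductive flat_algebra :: "('a::euclidean_space \<Rightarrow> real) \<Rightarrow> bool" where
  const: "flat_algebra (\<lambda>x. c)"
| flat: "flat_algebra (\<lambda>x. flat p (v \<bullet> x + c))"
| add: "flat_algebra f \<Longrightarrow> flat_algebra g \<Longrightarrow> flat_algebra (\<lambda>x. f x + g x)"
| mult: "flat_algebra f \<Longrightarrow> flat_algebra g \<Longrightarrow> flat_algebra (\<lambda>x. f x * g x)"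

lemma flat_algebra_prod:
  "finite I \<Longrightarrow> (\<And>i. i \<in> I \<Longrightarrow> flat_algebra (f i)) \<Longrightarrow> flat_algebra (\<lambda>x. \<Prod>i\<in>I. f i x)"
  by (induction I rule: finite_induct) (auto intro: flat_algebra.intros)

lemma flat_algebra_gradient:
  assumes "flat_algebra f"
  shows "\<exists>g. (\<forall>x. (f has_derivative (\<lambda>h. g x \<bullet> h)) (at x)) \<and> (\<forall>b. flat_algebra (\<lambda>x. g x \<bullet> b))"
  using assms
proof induction
  case (const c)
  show ?case
    by (rule exI[of _ "\<lambda>x. 0"]) (auto intro: flat_algebra.const)
next
  case (flat p v c)
  let ?p = "[:0, 0, 1:] * (p - pderiv p)"
  have "((\<lambda>x. flat p (v \<bullet> x + c)) has_derivative (\<lambda>h. (flat ?p (v \<bullet> x + c) *\<^sub>R v) \<bullet> h)) (at x)" for x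
  proof -
    have 1: "((\<lambda>x. v \<bullet> x + c) has_derivative (\<lambda>h. v \<bullet> h)) (at x)"
      by (auto intro!: derivative_eq_intros)
    have 2: "(flat p has_derivative (\<lambda>h. h * flat ?p (v \<bullet> x + c))) (at (v \<bullet> x + c))"
      using flat_has_real_derivative[of p "v \<bullet> x + c"]
      by (simp only: has_field_derivative_def mult_commute_abs)
    show ?thesis
      using has_derivative_compose[OF 1 2] by (simp add: mult.commute)
  qed
  moreover have "flat_algebra (\<lambda>x. (flat ?p (v \<bullet> x + c) *\<^sub>R v) \<bullet> b)" for b
    by (simp only: inner_scaleR_left) (intro flat_algebra.intros)
  ultimately show ?case
    by (intro exI[of _ "\<lambda>x. flat ?p (v \<bullet> x + c) *\<^sub>R v"]) auto
next
  case (add f1 f2)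
  then obtain g1 g2 where "\<And>x. (f1 has_derivative (\<lambda>h. g1 x \<bullet> h)) (at x)"
      "\<And>b. flat_algebra (\<lambda>x. g1 x \<bullet> b)"
      "\<And>x. (f2 has_derivative (\<lambda>h. g2 x \<bullet> h)) (at x)" "\<And>b. flat_algebra (\<lambda>x. g2 x \<bullet> b)"
    by blast
  then show ?case
    by (intro exI[of _ "\<lambda>x. g1 x + g2 x"])
      (auto simp: inner_add_left intro!: has_derivative_add flat_algebra.intros)
next
  case (mult f1 f2)
  then obtain g1 g2 where g: "\<And>x. (f1 has_derivative (\<lambda>h. g1 x \<bullet> h)) (at x)"
      "\<And>b. flat_algebra (\<lambda>x. g1 x \<bullet> b)"
      "\<And>x. (f2 has_derivative (\<lambda>h. g2 x \<bullet> h)) (at x)" "\<And>b. flat_algebra (\<lambda>x. g2 x \<bullet> b)"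
    by blast
  have "((\<lambda>x. f1 x * f2 x) has_derivative (\<lambda>h. (f1 x *\<^sub>R g2 x + f2 x *\<^sub>R g1 x) \<bullet> h)) (at x)" for x
    using has_derivative_mult[OF g(1)[of x] g(3)[of x]]
    by (simp add: inner_add_left mult.commute)
  moreover have "flat_algebra (\<lambda>x. (f1 x *\<^sub>R g2 x + f2 x *\<^sub>R g1 x) \<bullet> b)" for b
    using g mult.hyps by (simp add: inner_add_left flat_algebra.intros)
  ultimately show ?case
    by (intro exI[of _ "\<lambda>x. f1 x *\<^sub>R g2 x + f2 x *\<^sub>R g1 x"]) blast
qed

lemma flat_algebra_smooth: "flat_algebra f \<Longrightarrow> smooth f"
proof (coinduction arbitrary: f rule: smooth.coinduct)
  case (smooth f)
  then show ?case using flat_algebra_gradient[of f] by blast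
qed

section \<open>Smooth approximation of box indicators\<close>

definition box_bump :: "'a::euclidean_space \<Rightarrow> 'a \<Rightarrow> nat \<Rightarrow> 'a \<Rightarrow> real" where
  "box_bump a c n x = (\<Prod>b\<in>Basis.
     flat 1 (real (Suc n) * (x \<bullet> b - a \<bullet> b)) * flat 1 (real (Suc n) * (c \<bullet> b - x \<bullet> b)))"

lemma flat_1_bounds: "0 \<le> flat 1 x" "flat 1 x \<le> 1"
  by (auto simp: flat_def)

lemma box_bump_bounds: "0 \<le> box_bump a c n x" "box_bump a c n x \<le> 1"
  unfolding box_bump_def
  by (auto intro!: prod_nonneg prod_le_1 mult_nonneg_nonneg mult_le_one flat_1_bounds)

lemma box_bump_eq_0: "x \<notin> box a c \<Longrightarrow> box_bump a c n x = 0"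
  unfolding box_bump_def by (auto simp: mem_box flat_def zero_less_mult_iff)

text \<open>Stretching by \<open>Suc n\<close> turns a factor with positive argument s into
  exp(-1/((n+1) s)), which tends to 1. Off the box some factor has a nonpositive argument and
  vanishes for every n.\<close>

lemma box_bump_tendsto: "(\<lambda>n. box_bump a c n x) \<longlonglongrightarrow> indicator (box a c) x"
proof (cases "x \<in> box a c")
  case True
  have *: "(\<lambda>n. flat 1 (real (Suc n) * t)) \<longlonglongrightarrow> 1" if "t > 0" for t
  proof -
    have "(\<lambda>n. exp (- (inverse (real (Suc n)) * inverse t))) \<longlonglongrightarrow> exp (- (0 * inverse t))"
      by (intro tendsto_intros LIMSEQ_inverse_real_of_nat)
    moreover have "(\<lambda>n. flat 1 (real (Suc n) * t)) = (\<lambda>n. exp (- (inverse (real (Suc n)) * inverse t)))"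
      using that by (auto simp: flat_def fun_eq_iff)
    ultimately show ?thesis by simp
  qed
  have "(\<lambda>n. box_bump a c n x) \<longlonglongrightarrow> (\<Prod>b\<in>(Basis::'a set). 1 * 1)"
    unfolding box_bump_def using True
    by (intro tendsto_intros *) (auto simp: mem_box)
  then show ?thesis using True by simp
qed (simp add: box_bump_eq_0)

lemma box_bump_smooth: "smooth (box_bump a c n)"
proof -
  have 1: "real (Suc n) * (x \<bullet> b - a \<bullet> b) = (real (Suc n) *\<^sub>R b) \<bullet> x + (- (real (Suc n) * (a \<bullet> b)))"
    "real (Suc n) * (c \<bullet> b - x \<bullet> b) = (- (real (Suc n) *\<^sub>R b)) \<bullet> x + real (Suc n) * (c \<bullet> b)" for x b
    by (simp_all add: algebra_simps inner_commute)
  show ?thesis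
    unfolding box_bump_def [abs_def] 1
    by (intro flat_algebra_smooth flat_algebra_prod flat_algebra.mult flat_algebra.flat) simp
qed

lemma test_fun_box_bump:
  assumes "cbox a c \<subseteq> \<Omega>" shows "test_fun \<Omega> (box_bump a c n)"
proof -
  have "{x. box_bump a c n x \<noteq> 0} \<subseteq> cbox a c"
    using box_bump_eq_0 box_subset_cbox by blast
  then have *: "closure {x. box_bump a c n x \<noteq> 0} \<subseteq> cbox a c"
    by (intro closure_minimal) auto
  then have "compact (closure {x. box_bump a c n x \<noteq> 0})"
    by (metis closed_closure compact_Int_closed compact_cbox inf.absorb2)
  then show ?thesis
    using * assms box_bump_smooth by (auto simp: test_fun_def)
qed

lemma square_integrable_indicator_box:
  "square_integrable (indicator (box a c) :: 'a::euclidean_space \<Rightarrow> real)"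
proof -
  have "(\<lambda>x. (indicat_real (box a c) x)\<^sup>2) = indicat_real (box a c)"
    by (auto simp: fun_eq_iff indicator_def)
  then show ?thesis
    by (simp add: square_integrable_def emeasure_lborel_box_eq)
qed

text \<open>Dominated convergence along the bumps, which are test functions because the closed box
  lies in \<Omega>. They vanish off the box and are at most 1, so |g| cut off to the box dominates;
  it is integrable since the box indicator is square integrable.\<close>

lemma integral_box_eq_0:
  fixes g :: "'a::euclidean_space \<Rightarrow> real"
  assumes g: "square_integrable g" and sub: "cbox a c \<subseteq> \<Omega>"
    and orth: "\<And>\<phi>. test_fun \<Omega> \<phi> \<Longrightarrow> (\<integral>x. g x * \<phi> x \<partial>lborel) = 0"
  shows "(\<integral>x. g x * indicator (box a c) x \<partial>lborel) = 0"
proof -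
  have "(\<lambda>n. \<integral>x. g x * box_bump a c n x \<partial>lborel) \<longlonglongrightarrow> (\<integral>x. g x * indicator (box a c) x \<partial>lborel)"
  proof (rule integral_dominated_convergence[where w = "\<lambda>x. \<bar>g x * indicator (box a c) x\<bar>"])
    show "(\<lambda>x. g x * indicator (box a c) x) \<in> borel_measurable lborel"
      using g by (auto simp: square_integrable_def)
    show "(\<lambda>x. g x * box_bump a c n x) \<in> borel_measurable lborel" for n
      using g borel_measurable_continuous_onI[OF smooth_continuous[OF box_bump_smooth[of a c n]]]
      by (auto simp: square_integrable_def intro: borel_measurable_times)
    show "integrable lborel (\<lambda>x. \<bar>g x * indicator (box a c) x\<bar>)"
      by (intro integrable_abs square_integrable_mult g square_integrable_indicator_box)
    show "AE x in lborel. (\<lambda>n. g x * box_bump a c n x) \<longlonglongrightarrow> g x * indicator (box a c) x"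
      by (intro AE_I2 tendsto_intros box_bump_tendsto)
    show "AE x in lborel. norm (g x * box_bump a c n x) \<le> \<bar>g x * indicator (box a c) x\<bar>" for n
    proof (intro AE_I2)
      fix x
      show "norm (g x * box_bump a c n x) \<le> \<bar>g x * indicator (box a c) x\<bar>"
        using box_bump_bounds[of a c n x] box_bump_eq_0[of x a c n]
        by (cases "x \<in> box a c") (auto simp: abs_mult mult_left_le)
    qed
  qed
  then show ?thesis
    using orth[OF test_fun_box_bump[OF sub]] by (simp add: LIMSEQ_const_iff)
qed

text \<open>Boxes are an intersection-stable generator of the Borel sets, and the sets over which f
  integrates to zero form a Dynkin system. The vanishing total integral handles complements.\<close>

lemma AE_zero_if_box_integrals_zero:
  fixes f :: "'a::euclidean_space \<Rightarrow> real"
  assumes f: "integrable lborel f" and tot: "(\<integral>x. f x \<partial>lborel) = 0"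
    and box: "\<And>a c. (\<integral>x. indicator (box a c) x * f x \<partial>lborel) = 0"
  shows "AE x in lborel. f x = 0"
proof (rule sigma_finite_measure.density_zero[OF lborel.sigma_finite_measure_axioms f])
  fix A :: "'a set" assume "A \<in> sets lborel"
  let ?G = "range (\<lambda>(a, c). box a c :: 'a set)"
  have int: "integrable lborel (\<lambda>x. indicat_real B x * f x)" if "B \<in> sets borel" for B
    using integrable_mult_indicator[OF _ f, of B] that by simp
  have sets: "sigma_sets UNIV ?G = sets (borel :: 'a measure)"
    by (subst borel_eq_box) (simp add: sets_measure_of)
  have A: "A \<in> sigma_sets UNIV ?G"
    using \<open>A \<in> sets lborel\<close> sets by simp
  have G: "Int_stable ?G" "?G \<subseteq> Pow UNIV"
    by (auto simp: Int_stable_def box_Int_box)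
  from G A have "(\<integral>x. indicator A x * f x \<partial>lborel) = 0"
  proof (induction rule: sigma_sets_induct_disjoint)
    case (basic A)
    then show ?case using box by auto
  next
    case empty
    show ?case by simp
  next
    case (compl A)
    have "(\<integral>x. indicator (UNIV - A) x * f x \<partial>lborel) = (\<integral>x. f x - indicator A x * f x \<partial>lborel)"
      by (intro Bochner_Integration.integral_cong) (auto simp: indicator_def)
    also have "\<dots> = 0"
      using compl int[of A] sets by (subst Bochner_Integration.integral_diff) (auto simp: f tot)
    finally show ?case .
  next
    case (union A)
    have m: "range A \<subseteq> sets borel" using union(2) sets by simp
    then have "set_lebesgue_integral lborel (\<Union>i. A i) f = (\<Sum>i. set_lebesgue_integral lborel (A i) f)"
      using union(1) int[of "\<Union>i. A i"]
      by (intro lebesgue_integral_countable_add)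
        (auto simp: set_integrable_def disjoint_family_on_def)
    then show ?case using union(3) by (simp add: set_lebesgue_integral_def)
  qed
  then show "set_lebesgue_integral lborel A f = 0"
    by (simp add: set_lebesgue_integral_def)
qed

text \<open>The claim is local: it is proved on each box whose closed box lies in \<Omega>, and
  countably many such boxes cover \<Omega>, so the exceptional null sets can be united.\<close>

lemma fundamental_lemma_variations:
  fixes g :: "'a::euclidean_space \<Rightarrow> real"
  assumes g: "square_integrable g" and "open \<Omega>"
    and orth: "\<And>\<phi>. test_fun \<Omega> \<phi> \<Longrightarrow> (\<integral>x. g x * \<phi> x \<partial>lborel) = 0"
  shows "AE x in lborel. x \<in> \<Omega> \<longrightarrow> g x = 0"
proof -
  have loc: "AE x in lborel. x \<in> box a c \<longrightarrow> g x = 0" if sub: "cbox a c \<subseteq> \<Omega>" for a c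
  proof -
    have z: "(\<integral>x. g x * indicator (box a' c') x \<partial>lborel) = 0" if "box a' c' \<subseteq> box a c" for a' c'
    \<comment> \<open>An empty open box can have a nonempty closed box that leaves \<Omega>, so the
      inclusion of closures is argued for nonempty boxes only.\<close>
    proof (cases "box a' c' = {}")
      case False
      then have "cbox a' c' \<subseteq> cbox a c"
        using closure_mono[OF that] closure_box[of a' c'] closure_box[of a c] that by (cases "box a c = {}") auto
      then show ?thesis using integral_box_eq_0[OF g _ orth] sub by blast
    qed simp
    \<comment> \<open>Cutting g off to the box makes it integrable on the whole space. Its integrals
      over other boxes reduce to \<open>z\<close>, since two boxes intersect in a box.\<close>
    have "AE x in lborel. g x * indicator (box a c) x = 0"
    proof (rule AE_zero_if_box_integrals_zero)
      show "integrable lborel (\<lambda>x. g x * indicator (box a c) x)"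
        by (intro square_integrable_mult g square_integrable_indicator_box)
      show "(\<integral>x. g x * indicator (box a c) x \<partial>lborel) = 0" by (rule z) simp
      fix a' c'
      obtain p q where pq: "box a' c' \<inter> box a c = box p q" by (auto simp: box_Int_box)
      have *: "(\<lambda>x. indicator (box a' c') x * (g x * indicator (box a c) x)) = (\<lambda>x. g x * indicator (box p q) x)"
        unfolding pq[symmetric] by (auto simp: indicator_def)
      show "(\<integral>x. indicator (box a' c') x * (g x * indicator (box a c) x) \<partial>lborel) = 0"
        unfolding * using pq by (intro z) (metis Int_lower2)
    qed
    then show ?thesis by eventually_elim (auto simp: indicator_def)
  qed
  let ?F = "{box a c | a c. cbox a c \<subseteq> \<Omega>}"
  have "\<And>S. S \<in> ?F \<Longrightarrow> open S" by auto
  then obtain F where F: "F \<subseteq> ?F" "countable F" "\<Union>F = \<Union>?F"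
    by (rule Lindelof)
  have AE: "AE x in lborel. \<forall>S\<in>F. x \<in> S \<longrightarrow> g x = 0"
    unfolding AE_ball_countable[OF F(2)]
  proof
    fix S assume "S \<in> F"
    then obtain a c where "S = box a c" "cbox a c \<subseteq> \<Omega>" using F(1) by auto
    then show "AE x in lborel. x \<in> S \<longrightarrow> g x = 0" using loc by simp
  qed
  have "\<Omega> \<subseteq> \<Union>?F"
  proof
    fix x assume "x \<in> \<Omega>"
    with \<open>open \<Omega>\<close> obtain e where e: "e > 0" "cball x e \<subseteq> \<Omega>"
      using open_contains_cball by blast
    obtain a c where ac: "x \<in> box a c" "box a c \<subseteq> ball x e"
      using rational_boxes[OF e(1)] by blast
    have "closure (box a c) = cbox a c"
      using ac(1) by (intro closure_box) blast
    then have "cbox a c \<subseteq> cball x e"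
      using closure_mono[OF ac(2)] e(1) by simp
    then have "box a c \<in> ?F"
      using e(2) by (intro CollectI exI[of _ a] exI[of _ c]) auto
    then show "x \<in> \<Union>?F"
      using ac(1) by (rule UnionI)
  qed
  then have cover: "\<Omega> \<subseteq> \<Union>F" using F(3) by (rule ord_le_eq_trans[OF _ sym])
  show ?thesis
    using AE
  proof eventually_elim
    case (elim x)
    then show ?case using cover by (meson UnionE subsetD)
  qed
qed

section \<open>The gradient form\<close>

lemma L2_classE:
  obtains f where "square_integrable f" "v = L2_class f"
proof -
  have "\<exists>f. square_integrable f \<and> v = L2_class f"
    by (induction v rule: L2.abs_induct) (auto simp: L2_eq_def)
  then show ?thesis using that by blast
qed

lemma L2_eqI: "square_integrable f \<Longrightarrow> L2_eq f f"
  by (simp add: L2_eq_def)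

lemma vanishes_off_zero: "vanishes_off \<Omega> 0"
  by transfer simp

lemma vanishes_off_add: "vanishes_off \<Omega> v \<Longrightarrow> vanishes_off \<Omega> w \<Longrightarrow> vanishes_off \<Omega> (v + w)"
  by transfer (auto elim!: eventually_elim2)

lemma vanishes_off_scaleR: "vanishes_off \<Omega> v \<Longrightarrow> vanishes_off \<Omega> (c *\<^sub>R v)"
  by transfer (auto elim!: eventually_mono)

lemma subspace_L2_on: "subspace (L2_on \<Omega>)"
  by (auto simp: subspace_def L2_on_def vanishes_off_zero vanishes_off_add vanishes_off_scaleR)

text \<open>The fundamental lemma yields zero inside \<Omega>, membership in \<open>L2_on\<close>
  yields zero outside.\<close>

lemma L2_on_orthogonal_test_fun_eq_0:
  fixes v :: "'a::euclidean_space L2"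
  assumes "open \<Omega>" "v \<in> L2_on \<Omega>"
    and "\<And>\<phi>. test_fun \<Omega> \<phi> \<Longrightarrow> inner v (L2_class \<phi>) = 0"
  shows "v = 0"
proof -
  obtain f where f: "square_integrable f" and v: "v = L2_class f"
    by (rule L2_classE)
  have "AE x in lborel. x \<in> \<Omega> \<longrightarrow> f x = 0"
  proof (rule fundamental_lemma_variations[OF f \<open>open \<Omega>\<close>])
    show "(\<integral>x. f x * \<phi> x \<partial>lborel) = 0" if "test_fun \<Omega> \<phi>" for \<phi>
      using assms(3)[OF that] f test_fun_square_integrable[OF that]
      by (simp add: v inner_L2.abs_eq L2_eqI)
  qed
  moreover have "AE x in lborel. x \<notin> \<Omega> \<longrightarrow> f x = 0"
    using assms(2) f by (simp add: L2_on_def v vanishes_off.abs_eq L2_eqI)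
  ultimately have "AE x in lborel. f x = 0"
    by eventually_elim auto
  then have "L2_eq f (\<lambda>x. 0)"
    using f by (simp add: L2_eq_def square_integrable_zero)
  then show ?thesis
    unfolding v zero_L2_def by (simp add: Quotient3_rel_abs[OF Quotient3_L2])
qed

text \<open>The difference of two candidates is orthogonal to all test functions. This gives the
  description in \<open>pd\<close> a definite value, on which the linearity of \<open>pd\<close>
  rests.\<close>

lemma weak_pderiv_unique:
  assumes "open \<Omega>" "weak_pderiv \<Omega> b v g" "weak_pderiv \<Omega> b v g'"
  shows "g = g'"
proof -
  have "g - g' = 0"
    using assms(2,3)
    by (intro L2_on_orthogonal_test_fun_eq_0[OF assms(1)])
      (auto simp: weak_pderiv_def inner_diff_left intro: subspace_diff[OF subspace_L2_on])
  then show ?thesis by simp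
qed

lemma weak_pderiv_add:
  "weak_pderiv \<Omega> b v g \<Longrightarrow> weak_pderiv \<Omega> b w h \<Longrightarrow> weak_pderiv \<Omega> b (v + w) (g + h)"
  by (auto simp: weak_pderiv_def inner_add_left intro: subspace_add[OF subspace_L2_on])

lemma weak_pderiv_scaleR: "weak_pderiv \<Omega> b v g \<Longrightarrow> weak_pderiv \<Omega> b (c *\<^sub>R v) (c *\<^sub>R g)"
  by (auto simp: weak_pderiv_def intro: subspace_scale[OF subspace_L2_on])

lemma pd_eqI: "open \<Omega> \<Longrightarrow> weak_pderiv \<Omega> b v g \<Longrightarrow> pd \<Omega> b v = g"
  unfolding pd_def using weak_pderiv_unique by blast

lemma weak_pderiv_pd:
  "open \<Omega> \<Longrightarrow> v \<in> H1 \<Omega> \<Longrightarrow> b \<in> Basis \<Longrightarrow> weak_pderiv \<Omega> b v (pd \<Omega> b v)"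
  using pd_eqI by (force simp: H1_def)

lemma pd_add:
  "open \<Omega> \<Longrightarrow> v \<in> H1 \<Omega> \<Longrightarrow> w \<in> H1 \<Omega> \<Longrightarrow> b \<in> Basis \<Longrightarrow> pd \<Omega> b (v + w) = pd \<Omega> b v + pd \<Omega> b w"
  by (intro pd_eqI weak_pderiv_add weak_pderiv_pd)

lemma pd_scaleR:
  "open \<Omega> \<Longrightarrow> v \<in> H1 \<Omega> \<Longrightarrow> b \<in> Basis \<Longrightarrow> pd \<Omega> b (c *\<^sub>R v) = c *\<^sub>R pd \<Omega> b v"
  by (intro pd_eqI weak_pderiv_scaleR weak_pderiv_pd)

lemma grad_form_sym: "grad_form \<Omega> v w = grad_form \<Omega> w v"
  by (simp add: grad_form_def inner_commute)

lemma grad_form_add_left: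
  "open \<Omega> \<Longrightarrow> v \<in> H1 \<Omega> \<Longrightarrow> v' \<in> H1 \<Omega> \<Longrightarrow>
    grad_form \<Omega> (v + v') w = grad_form \<Omega> v w + grad_form \<Omega> v' w"
  by (simp add: grad_form_def pd_add inner_add_left sum.distrib)

lemma grad_form_scaleR_left:
  "open \<Omega> \<Longrightarrow> v \<in> H1 \<Omega> \<Longrightarrow> grad_form \<Omega> (c *\<^sub>R v) w = c * grad_form \<Omega> v w"
  by (simp add: grad_form_def pd_scaleR sum_distrib_left)

lemma H1_seminorm_power2: "(H1_seminorm \<Omega> v)\<^sup>2 = grad_form \<Omega> v v"
  by (simp add: H1_seminorm_def grad_form_def sum_nonneg)

section \<open>Operators on finite-dimensional subspaces\<close>

text \<open>Everything is relative to \<open>V\<close> because \<open>grad_form\<close> is linear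
  only on \<open>H1\<close>. One Gram-Schmidt process then serves both the inner product and the
  gradient form.\<close>

locale positive_definite_form =
  fixes V :: "'b::real_vector set" and f :: "'b \<Rightarrow> 'b \<Rightarrow> real"
  assumes subspace: "subspace V"
    and sym: "x \<in> V \<Longrightarrow> y \<in> V \<Longrightarrow> f x y = f y x"
    and add_left: "x \<in> V \<Longrightarrow> y \<in> V \<Longrightarrow> z \<in> V \<Longrightarrow> f (x + y) z = f x z + f y z"
    and scaleR_left: "x \<in> V \<Longrightarrow> y \<in> V \<Longrightarrow> f (c *\<^sub>R x) y = c * f x y"
    and pos: "x \<in> V \<Longrightarrow> x \<noteq> 0 \<Longrightarrow> f x x > 0"
begin

definition orthonormal :: "'b set \<Rightarrow> bool" where
  "orthonormal E \<longleftrightarrow> finite E \<and> E \<subseteq> V \<and> (\<forall>x\<in>E. \<forall>y\<in>E. f x y = (if x = y then 1 else 0))"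

lemma sum_left:
  assumes "\<And>i. i \<in> I \<Longrightarrow> g i \<in> V" "w \<in> V"
  shows "f (\<Sum>i\<in>I. g i) w = (\<Sum>i\<in>I. f (g i) w)"
proof -
  have "f 0 w = 0"
    using scaleR_left[of 0 w 0] subspace_0[OF subspace] assms(2) by simp
  then show ?thesis
    using assms
    by (induction I rule: infinite_finite_induct) (auto simp: add_left subspace_sum[OF subspace])
qed

lemma sum_right:
  assumes "\<And>i. i \<in> I \<Longrightarrow> g i \<in> V" "w \<in> V"
  shows "f w (\<Sum>i\<in>I. g i) = (\<Sum>i\<in>I. f w (g i))"
proof -
  have "f w (\<Sum>i\<in>I. g i) = f (\<Sum>i\<in>I. g i) w"
    using assms by (intro sym subspace_sum[OF subspace])
  also have "\<dots> = (\<Sum>i\<in>I. f (g i) w)" by (rule sum_left[OF assms])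
  also have "\<dots> = (\<Sum>i\<in>I. f w (g i))" using assms by (intro sum.cong refl sym)
  finally show ?thesis .
qed

lemma scaleR_right: "x \<in> V \<Longrightarrow> y \<in> V \<Longrightarrow> f x (c *\<^sub>R y) = c * f x y"
  using sym[of x "c *\<^sub>R y"] sym[of x y] scaleR_left subspace_scale[OF subspace] by simp

lemma orthonormal_sum_left:
  assumes E: "orthonormal E" and "d \<in> E"
  shows "f (\<Sum>e\<in>E. c e *\<^sub>R e) d = c d"
proof -
  have "f (\<Sum>e\<in>E. c e *\<^sub>R e) d = (\<Sum>e\<in>E. c e * f e d)"
    using assms by (subst sum_left) (auto simp: orthonormal_def scaleR_left subspace_scale[OF subspace] subset_iff)
  also have "\<dots> = (\<Sum>e\<in>E. if e = d then c e else 0)"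
    using assms by (intro sum.cong) (auto simp: orthonormal_def)
  finally show ?thesis using assms by (simp add: orthonormal_def)
qed

lemma orthonormal_expansion:
  assumes E: "orthonormal E" and x: "x \<in> span E"
  shows "(\<Sum>e\<in>E. f x e *\<^sub>R e) = x"
proof -
  obtain c where "x = (\<Sum>e\<in>E. c e *\<^sub>R e)"
    using x E by (auto simp: orthonormal_def span_finite)
  then show ?thesis using orthonormal_sum_left[OF E] by simp
qed

lemma Gram_Schmidt:
  assumes "finite B" "B \<subseteq> V"
  shows "\<exists>E. orthonormal E \<and> span E = span B"
  using assms
proof (induction B rule: finite_induct)
  case empty
  show ?case by (rule exI[of _ "{}"]) (simp add: orthonormal_def)
next
  case (insert b B)
  then obtain E where E: "orthonormal E" "span E = span B" by auto
  have EV: "finite E" "E \<subseteq> V" using E(1) by (auto simp: orthonormal_def)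
  define w where "w = b - (\<Sum>e\<in>E. f b e *\<^sub>R e)"
  have sumV: "(\<Sum>e\<in>E. f b e *\<^sub>R e) \<in> V"
    using EV by (intro subspace_sum[OF subspace] subspace_scale[OF subspace]) auto
  then have wV: "w \<in> V"
    using insert.prems subspace_diff[OF subspace] by (simp add: w_def)
  have sum_span: "(\<Sum>e\<in>E. f b e *\<^sub>R e) \<in> span E"
    by (intro span_sum span_scale span_base)
  have "w - b \<in> span E"
    using span_neg[OF sum_span] by (simp add: w_def)
  then have "span (insert w E) = span (insert b E)"
    by (rule eq_span_insert_eq)
  then have span_w: "span (insert w E) = span (insert b B)"
    by (simp add: span_insert E(2))
  show ?case
  proof (cases "w = 0")
    case True
    then have "b \<in> span B" using sum_span E(2) by (simp add: w_def)
    then show ?thesis using E by (auto simp: span_redundant)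
  next
    case False
    define k where "k = inverse (sqrt (f w w))"
    have fw: "f w w > 0" using pos[OF wV False] .
    then have k: "k \<noteq> 0" "k * (k * f w w) = 1"
      by (auto simp: k_def field_simps)
    have orth: "f w d = 0" if d: "d \<in> E" for d
    proof -
      have "d \<in> V" using EV d by auto
      then have "f b d = f w d + f (\<Sum>e\<in>E. f b e *\<^sub>R e) d"
        using add_left[OF wV sumV] by (simp add: w_def)
      then show ?thesis using orthonormal_sum_left[OF E(1) d] by simp
    qed
    have kw: "k *\<^sub>R w \<in> V" by (rule subspace_scale[OF subspace wV])
    have 1: "f (k *\<^sub>R w) (k *\<^sub>R w) = 1"
      using k kw wV by (simp add: scaleR_left scaleR_right)
    have 2: "f (k *\<^sub>R w) d = 0" "f d (k *\<^sub>R w) = 0" if "d \<in> E" for d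
      using orth[OF that] that EV kw wV sym[of d "k *\<^sub>R w"] by (auto simp: scaleR_left)
    have "k *\<^sub>R w \<notin> E" using 1 2 by force
    then have "orthonormal (insert (k *\<^sub>R w) E)"
      using E(1) 1 2 kw by (auto simp: orthonormal_def)
    moreover have "span (insert (k *\<^sub>R w) E) = span (insert w E)"
    proof -
      have "w \<in> span (insert (k *\<^sub>R w) E)"
        using k(1) span_scale[OF span_base[of "k *\<^sub>R w" "insert (k *\<^sub>R w) E"], of "inverse k"] by simp
      moreover have "k *\<^sub>R w \<in> span (insert w E)"
        by (intro span_scale span_base) simp
      moreover have "E \<subseteq> span (insert w E)" "E \<subseteq> span (insert (k *\<^sub>R w) E)"
        using span_superset by blast+
      ultimately show ?thesis
        by (simp add: span_eq)
    qed
    ultimately show ?thesis using span_w by auto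
  qed
qed

end

lemma positive_definite_form_inner: "subspace V \<Longrightarrow> positive_definite_form V inner"
  by unfold_locales (simp_all add: inner_add_left, rule inner_commute)

text \<open>A bounded linear retraction commutes with time derivatives; through it the derivative of
  a curve in \<open>span B\<close> is seen to stay in \<open>span B\<close>.\<close>

lemma finite_span_projection:
  fixes B :: "'b::real_inner set"
  assumes "finite B"
  obtains P where "bounded_linear P" "\<And>x. P x \<in> span B" "\<And>x. x \<in> span B \<Longrightarrow> P x = x"
proof -
  interpret positive_definite_form "UNIV :: 'b set" inner
    by (rule positive_definite_form_inner) simp
  obtain E where E: "orthonormal E" "span E = span B"
    using Gram_Schmidt[OF assms] by auto
  show ?thesis
  proof
    show "bounded_linear (\<lambda>x. \<Sum>e\<in>E. inner x e *\<^sub>R e)"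
      by (intro bounded_linear_sum bounded_linear_compose[OF bounded_linear_scaleR_left bounded_linear_inner_left])
    show "(\<Sum>e\<in>E. inner x e *\<^sub>R e) \<in> span B" for x
      unfolding E(2)[symmetric] by (intro span_sum span_scale span_base)
    show "(\<Sum>e\<in>E. inner x e *\<^sub>R e) = x" if "x \<in> span B" for x
      using orthonormal_expansion[OF E(1)] that E(2) by simp
  qed
qed

section \<open>The discrete Laplacian and its inverse\<close>

context
  fixes B :: "'b::real_inner set" and a :: "'b \<Rightarrow> 'b \<Rightarrow> real"
  assumes fin: "finite B" and form: "positive_definite_form (span B) a"
begin

text \<open>This is the operator A_h, extended to the whole space by orthogonal projection so that
  it is a total bounded linear map.\<close>

lemma form_operator:
  obtains A where "bounded_linear A" "\<And>x. A x \<in> span B"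
    "\<And>x y. x \<in> span B \<Longrightarrow> y \<in> span B \<Longrightarrow> inner (A x) y = a x y"
proof -
  interpret inner: positive_definite_form "span B" inner
    by (rule positive_definite_form_inner) simp
  interpret a: positive_definite_form "span B" a
    by (rule form)
  obtain E where E: "inner.orthonormal E" "span E = span B"
    using inner.Gram_Schmidt[OF fin] span_superset by blast
  have ES: "e \<in> span B" if "e \<in> E" for e
    using E that by (auto simp: inner.orthonormal_def)
  \<comment> \<open>The coefficient along d is a(P x, d), where P is the orthogonal projection onto
    \<open>span B\<close> written in the orthonormal basis.\<close>
  define A where "A = (\<lambda>x. \<Sum>d\<in>E. (\<Sum>e\<in>E. inner x e * a e d) *\<^sub>R d)"
  show ?thesis
  proof
    show "bounded_linear A"
      unfolding A_def
      by (intro bounded_linear_sum bounded_linear_compose[OF bounded_linear_scaleR_left]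
          bounded_linear_compose[OF bounded_linear_mult_left bounded_linear_inner_left])
    show "A x \<in> span B" for x
      unfolding A_def by (intro span_sum span_scale ES)
    fix x y assume x: "x \<in> span B" and y: "y \<in> span B"
    have exp: "(\<Sum>e\<in>E. inner z e *\<^sub>R e) = z" if "z \<in> span B" for z
      using inner.orthonormal_expansion[OF E(1)] that E(2) by simp
    have 1: "(\<Sum>e\<in>E. inner x e * a e d) = a x d" if d: "d \<in> E" for d
    proof -
      have "a (\<Sum>e\<in>E. inner x e *\<^sub>R e) d = (\<Sum>e\<in>E. inner x e * a e d)"
        using d ES by (subst a.sum_left) (auto simp: a.scaleR_left span_scale)
      then show ?thesis using exp[OF x] by simp
    qed
    have "a x (\<Sum>d\<in>E. inner y d *\<^sub>R d) = (\<Sum>d\<in>E. inner y d * a x d)"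
      using x ES by (subst a.sum_right) (auto simp: a.scaleR_right span_scale)
    then show "inner (A x) y = a x y"
      using exp[OF y] 1
      by (simp add: A_def inner_sum_left inner_commute[of y] mult.commute)
  qed
qed

text \<open>Taking the basis orthonormal for \<open>a\<close> instead of for the inner product makes
  the solution operator explicit: the coefficient of \<open>G x\<close> along e is (x, e).\<close>

lemma form_inverse_operator:
  obtains G where "bounded_linear G" "\<And>x. G x \<in> span B"
    "\<And>x y. y \<in> span B \<Longrightarrow> a (G x) y = inner x y"
proof -
  interpret a: positive_definite_form "span B" a
    by (rule form)
  obtain E where E: "a.orthonormal E" "span E = span B"
    using a.Gram_Schmidt[OF fin] span_superset by blast
  have ES: "e \<in> span B" if "e \<in> E" for e
    using E that by (auto simp: a.orthonormal_def)
  define G where "G = (\<lambda>x. \<Sum>e\<in>E. inner x e *\<^sub>R e)"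
  show ?thesis
  proof
    show "bounded_linear G"
      unfolding G_def
      by (intro bounded_linear_sum bounded_linear_compose[OF bounded_linear_scaleR_left bounded_linear_inner_left])
    show "G x \<in> span B" for x
      unfolding G_def by (intro span_sum span_scale ES)
    fix x y assume y: "y \<in> span B"
    have "inner x (\<Sum>e\<in>E. a y e *\<^sub>R e) = (\<Sum>e\<in>E. inner x e * a e y)"
      using y ES by (auto simp: inner_sum_right a.sym mult.commute intro!: sum.cong)
    also have "\<dots> = a (G x) y"
      unfolding G_def using y ES by (subst a.sum_left) (auto simp: a.scaleR_left span_scale)
    finally show "a (G x) y = inner x y"
      using a.orthonormal_expansion[OF E(1)] y E(2) by simp
  qed
qed

end

section \<open>Decay for the abstract damped wave equation\<close>

text \<open>Gronwall's argument: exp(c t) L(t) is nonincreasing. At 0 the derivative is one-sided,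
  so interior derivatives are combined with continuity on the closed interval.\<close>

lemma exp_decay:
  fixes L L' :: "real \<Rightarrow> real"
  assumes der: "\<And>t. t \<ge> 0 \<Longrightarrow> (L has_vector_derivative L' t) (at t within {0..})"
    and le: "\<And>t. t \<ge> 0 \<Longrightarrow> L' t \<le> - c * L t" and "t \<ge> 0"
  shows "L t \<le> exp (- c * t) * L 0"
proof -
  have "exp (c * t) * L t \<le> exp (c * 0) * L 0"
  proof (rule DERIV_nonpos_imp_decreasing_open[where f = "\<lambda>t. exp (c * t) * L t"])
    show "0 \<le> t" by fact
    have "continuous_on {0..} L"
      using der by (intro continuous_on_vector_derivative) auto
    then show "continuous_on {0..t} (\<lambda>t. exp (c * t) * L t)"
      by (intro continuous_intros) (auto intro: continuous_on_subset)
    fix s assume s: "0 < s" "s < t"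
    then have "s \<in> interior {0..}" by simp
    then have "(L has_real_derivative L' s) (at s)"
      using der[of s] s(1) at_within_interior[of s "{0..}"]
      by (simp add: has_real_derivative_iff_has_vector_derivative)
    then have "((\<lambda>t. exp (c * t) * L t) has_real_derivative exp (c * s) * (c * L s + L' s)) (at s)"
      by (auto intro!: derivative_eq_intros simp: algebra_simps)
    moreover have "exp (c * s) * (c * L s + L' s) \<le> 0"
      using le[of s] s by (simp add: mult_le_0_iff)
    ultimately show "\<exists>y. ((\<lambda>t. exp (c * t) * L t) has_real_derivative y) (at s) \<and> y \<le> 0"
      by blast
  qed
  then show ?thesis
    by (simp add: exp_minus field_simps)
qed

text \<open>The equation u'' + \<beta> A u' + \<alpha> u' + A u = 0 in the discrete space
  \<open>S\<close>, solved for u''. \<open>G\<close> is the discrete solution operator and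
  \<open>coercive\<close> is the Poincare inequality.\<close>

locale damped_wave =
  fixes S :: "'b::real_inner set" and A G :: "'b \<Rightarrow> 'b" and \<alpha> \<beta> lam :: real
    and u u' :: "real \<Rightarrow> 'b"
  assumes sub: "subspace S" and A_bl: "bounded_linear A" and G_bl: "bounded_linear G"
    and A_in: "\<And>x. x \<in> S \<Longrightarrow> A x \<in> S" and G_in: "\<And>x. x \<in> S \<Longrightarrow> G x \<in> S"
    and A_sym: "\<And>x y. x \<in> S \<Longrightarrow> y \<in> S \<Longrightarrow> inner (A x) y = inner (A y) x"
    and AG: "\<And>x. x \<in> S \<Longrightarrow> A (G x) = x"
    and coercive: "\<And>x. x \<in> S \<Longrightarrow> lam * inner x x \<le> inner (A x) x"
    and lam: "lam > 0"
    and u_in: "\<And>t. t \<ge> 0 \<Longrightarrow> u t \<in> S" and u'_in: "\<And>t. t \<ge> 0 \<Longrightarrow> u' t \<in> S"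
    and u_der: "\<And>t. t \<ge> 0 \<Longrightarrow> (u has_vector_derivative u' t) (at t within {0..})"
    and u'_der: "\<And>t. t \<ge> 0 \<Longrightarrow>
      (u' has_vector_derivative - (\<beta> *\<^sub>R A (u' t) + \<alpha> *\<^sub>R u' t + A (u t))) (at t within {0..})"
begin

sublocale A: bounded_linear A by (rule A_bl)
sublocale G: bounded_linear G by (rule G_bl)

lemmas in_S = subspace_add[OF sub] subspace_diff[OF sub] subspace_scale[OF sub]

lemma A_nonneg: "x \<in> S \<Longrightarrow> 0 \<le> inner (A x) x"
  using coercive[of x] lam by (smt (verit) inner_ge_zero mult_nonneg_nonneg)

lemma G_sym: "x \<in> S \<Longrightarrow> y \<in> S \<Longrightarrow> inner (G x) y = inner (G y) x"
  using A_sym[of "G x" "G y"] AG G_in by (metis inner_commute)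

lemma G_nonneg: "x \<in> S \<Longrightarrow> 0 \<le> inner (G x) x"
  using A_nonneg[of "G x"] by (simp add: AG G_in inner_commute)

text \<open>Expand |x - lam G x|^2 \<ge> 0 and apply coercivity at \<open>G x\<close>, which gives
  lam |G x|^2 \<le> (G x, x).\<close>

lemma G_bound:
  assumes x: "x \<in> S" shows "lam * inner (G x) x \<le> inner x x"
proof -
  have "0 \<le> inner (x - lam *\<^sub>R G x) (x - lam *\<^sub>R G x)" by simp
  also have "\<dots> = inner x x - 2 * lam * inner (G x) x + lam * (lam * inner (G x) (G x))"
    by (simp add: inner_diff_left inner_diff_right inner_commute algebra_simps)
  also have "\<dots> \<le> inner x x - 2 * lam * inner (G x) x + lam * inner (G x) x"
    using coercive[OF G_in[OF x]] lam AG[OF x] by (simp add: inner_commute)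
  finally show ?thesis by simp
qed

text \<open>Twice the energy, so that no factor 1/2 is carried through the estimates.\<close>

definition double_energy :: "real \<Rightarrow> real" where
  "double_energy t = inner (u' t) (u' t) + inner (A (u t)) (u t)"

section \<open>Decay of the shifted energy\<close>

definition shifted_energy :: "real \<Rightarrow> real \<Rightarrow> real" where
  "shifted_energy \<delta> t = inner (u' t + \<delta> *\<^sub>R u t) (u' t + \<delta> *\<^sub>R u t)
     + (1 - \<beta> * \<delta>) * inner (A (u t)) (u t) + (\<delta>\<^sup>2 - \<alpha> * \<delta>) * inner (u t) (u t)"

lemma A_u_der: "t \<ge> 0 \<Longrightarrow> ((\<lambda>t. A (u t)) has_vector_derivative A (u' t)) (at t within {0..})"
  by (rule A.has_vector_derivative[OF u_der])

lemmas inner_der = bounded_bilinear.has_vector_derivative[OF bounded_bilinear_inner]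

lemma shifted_energy_decay:
  assumes "2 * \<delta> \<le> \<alpha> + \<beta> * lam" "\<beta> \<ge> 0" "t \<ge> 0"
  shows "shifted_energy \<delta> t \<le> exp (- (2 * \<delta>) * t) * shifted_energy \<delta> 0"
proof (rule exp_decay[OF _ _ \<open>t \<ge> 0\<close>])
  let ?z = "\<lambda>t. - (\<beta> *\<^sub>R A (u' t) + \<alpha> *\<^sub>R u' t + A (u t))"
  let ?L' = "\<lambda>t. 2 * inner (u' t + \<delta> *\<^sub>R u t) (?z t + \<delta> *\<^sub>R u' t)
     + (1 - \<beta> * \<delta>) * (2 * inner (A (u t)) (u' t)) + (\<delta>\<^sup>2 - \<alpha> * \<delta>) * (2 * inner (u t) (u' t))"
  fix t :: real assume t: "t \<ge> 0"
  have p: "((\<lambda>t. u' t + \<delta> *\<^sub>R u t) has_vector_derivative ?z t + \<delta> *\<^sub>R u' t) (at t within {0..})"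
    by (intro has_vector_derivative_add u'_der t
        bounded_linear.has_vector_derivative[OF bounded_linear_scaleR_right u_der])
  have 1: "((\<lambda>t. inner (u' t + \<delta> *\<^sub>R u t) (u' t + \<delta> *\<^sub>R u t)) has_vector_derivative
      2 * inner (u' t + \<delta> *\<^sub>R u t) (?z t + \<delta> *\<^sub>R u' t)) (at t within {0..})"
    by (rule has_vector_derivative_eq_rhs[OF inner_der[OF p p]]) (simp only: inner_commute[of "_ + \<delta> *\<^sub>R u' t"] mult_2)
  have 2: "((\<lambda>t. inner (A (u t)) (u t)) has_vector_derivative 2 * inner (A (u t)) (u' t)) (at t within {0..})"
    by (rule has_vector_derivative_eq_rhs[OF inner_der[OF A_u_der[OF t] u_der[OF t]]])
      (use t u_in u'_in A_sym in simp)
  have 3: "((\<lambda>t. inner (u t) (u t)) has_vector_derivative 2 * inner (u t) (u' t)) (at t within {0..})"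
    by (rule has_vector_derivative_eq_rhs[OF inner_der[OF u_der[OF t] u_der[OF t]]])
      (simp add: inner_commute)
  show "(shifted_energy \<delta> has_vector_derivative ?L' t) (at t within {0..})"
    unfolding shifted_energy_def [abs_def]
    by (intro has_vector_derivative_add 1
        bounded_linear.has_vector_derivative[OF bounded_linear_mult_right] 2 3)
  define p where "p = u' t + \<delta> *\<^sub>R u t"
  have pS: "p \<in> S" unfolding p_def using t by (intro in_S u_in u'_in)
  have sym: "inner (A (u' t)) (u t) = inner (A (u t)) (u' t)" "inner (u' t) (u t) = inner (u t) (u' t)"
    "inner (u t) (A (u t)) = inner (A (u t)) (u t)"
    "inner (u' t) (A (u t)) = inner (A (u t)) (u' t)" "inner (u t) (A (u' t)) = inner (A (u t)) (u' t)"
    "inner (u' t) (A (u' t)) = inner (A (u' t)) (u' t)"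
    using A_sym u_in u'_in t by (auto simp: inner_commute)
  \<comment> \<open>The weights in \<open>shifted_energy\<close> are such that all mixed terms in u
    and u' combine into quadratic forms of p alone.\<close>
  have "?L' t + 2 * \<delta> * shifted_energy \<delta> t = - 2 * (\<beta> * inner (A p) p + (\<alpha> - 2 * \<delta>) * inner p p)"
    unfolding shifted_energy_def p_def
    by (simp add: A.add A.scaleR inner_add_left inner_add_right sym power2_eq_square algebra_simps)
  moreover have "0 \<le> \<beta> * inner (A p) p + (\<alpha> - 2 * \<delta>) * inner p p"
  proof -
    have "0 \<le> (\<beta> * lam + (\<alpha> - 2 * \<delta>)) * inner p p" using assms by simp
    moreover have "\<beta> * (lam * inner p p) \<le> \<beta> * inner (A p) p"
      using coercive[OF pS] \<open>\<beta> \<ge> 0\<close> by (rule mult_left_mono)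
    ultimately show ?thesis by (simp add: algebra_simps)
  qed
  ultimately show "?L' t \<le> - (2 * \<delta>) * shifted_energy \<delta> t" by simp
qed

section \<open>The dual functional for \<alpha> = 0\<close>

lemma GA: assumes x: "x \<in> S" shows "G (A x) = x"
proof -
  have d: "G (A x) - x \<in> S" using x by (intro in_S G_in A_in)
  \<comment> \<open>Coercivity makes \<open>A\<close> injective on \<open>S\<close>, and
    \<open>AG\<close> shows that \<open>A\<close> sends this difference to 0.\<close>
  have "lam * inner (G (A x) - x) (G (A x) - x) \<le> 0"
    using coercive[OF d] AG[OF A_in[OF x]] by (simp add: A.diff)
  then have "inner (G (A x) - x) (G (A x) - x) \<le> 0"
    using lam by (simp add: mult_le_0_iff)
  then show ?thesis
    by (metis inner_eq_zero_iff inner_ge_zero order_antisym right_minus_eq)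
qed

text \<open>For \<alpha> = 0, applying \<open>G\<close> to the equation gives (G u' + \<beta> u)' =
  -u. Hence the derivative of this quantity is -u - \<delta> G u', free of \<open>A\<close>.\<close>

definition dual_var :: "real \<Rightarrow> real \<Rightarrow> 'b" where
  "dual_var \<delta> t = G (u' t) + \<beta> *\<^sub>R u t - \<delta> *\<^sub>R G (u t)"

definition dual_energy :: "real \<Rightarrow> real \<Rightarrow> real" where
  "dual_energy \<delta> t = inner (A (dual_var \<delta> t)) (dual_var \<delta> t)
     + (1 - \<beta> * \<delta>) * inner (u t) (u t) + \<delta>\<^sup>2 * inner (G (u t)) (u t)"

lemma dual_var_in: "t \<ge> 0 \<Longrightarrow> dual_var \<delta> t \<in> S"
  unfolding dual_var_def by (intro in_S G_in u_in u'_in)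

text \<open>In F' + 2 \<delta> F all terms with u' cancel. What is left is -2 times (1 - \<beta>
  \<delta>) (\<beta> |u|_1^2 - 2 \<delta> |u|^2) + \<delta>^2 (\<beta> |u|^2 - 2 \<delta> (G u, u)).
  As 2 \<delta> \<le> \<beta> lam, the two brackets are nonnegative by coercivity and by
  \<open>G_bound\<close>.\<close>

lemma dual_energy_decay:
  assumes "\<alpha> = 0" "\<delta> \<ge> 0" "2 * \<delta> \<le> \<beta> * lam" "\<beta> \<ge> 0" "\<beta> * \<delta> \<le> 1" "t \<ge> 0"
  shows "dual_energy \<delta> t \<le> exp (- (2 * \<delta>) * t) * dual_energy \<delta> 0"
proof (rule exp_decay[OF _ _ \<open>t \<ge> 0\<close>])
  let ?r' = "\<lambda>t. - u t - \<delta> *\<^sub>R G (u' t)"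
  let ?F' = "\<lambda>t. 2 * inner (A (dual_var \<delta> t)) (?r' t)
     + (1 - \<beta> * \<delta>) * (2 * inner (u t) (u' t)) + \<delta>\<^sup>2 * (2 * inner (G (u t)) (u' t))"
  fix t :: real assume t: "t \<ge> 0"
  note uS = u_in[OF t] u'_in[OF t]
  have "(dual_var \<delta> has_vector_derivative
      G (- (\<beta> *\<^sub>R A (u' t) + \<alpha> *\<^sub>R u' t + A (u t))) + \<beta> *\<^sub>R u' t - \<delta> *\<^sub>R G (u' t)) (at t within {0..})"
    unfolding dual_var_def [abs_def]
    by (intro has_vector_derivative_add has_vector_derivative_diff t G.has_vector_derivative u'_der u_der
        bounded_linear.has_vector_derivative[OF bounded_linear_scaleR_right])
  moreover have "G (- (\<beta> *\<^sub>R A (u' t) + \<alpha> *\<^sub>R u' t + A (u t))) + \<beta> *\<^sub>R u' t - \<delta> *\<^sub>R G (u' t) = ?r' t"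
    using \<open>\<alpha> = 0\<close> uS by (simp add: G.neg G.add G.diff G.scaleR GA)
  ultimately have r: "(dual_var \<delta> has_vector_derivative ?r' t) (at t within {0..})"
    by simp
  have r'S: "?r' t \<in> S"
    using uS by (intro in_S G_in subspace_neg[OF sub])
  have 1: "((\<lambda>t. inner (A (dual_var \<delta> t)) (dual_var \<delta> t)) has_vector_derivative
      2 * inner (A (dual_var \<delta> t)) (?r' t)) (at t within {0..})"
    by (rule has_vector_derivative_eq_rhs[OF inner_der[OF A.has_vector_derivative[OF r] r]])
      (simp only: A_sym[OF r'S dual_var_in[OF t]] mult_2)
  have 2: "((\<lambda>t. inner (u t) (u t)) has_vector_derivative 2 * inner (u t) (u' t)) (at t within {0..})"
    by (rule has_vector_derivative_eq_rhs[OF inner_der[OF u_der[OF t] u_der[OF t]]])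
      (simp add: inner_commute)
  have 3: "((\<lambda>t. inner (G (u t)) (u t)) has_vector_derivative 2 * inner (G (u t)) (u' t)) (at t within {0..})"
    by (rule has_vector_derivative_eq_rhs[OF inner_der[OF G.has_vector_derivative[OF u_der[OF t]] u_der[OF t]]])
      (simp only: G_sym[OF uS(2,1)] mult_2)
  show "(dual_energy \<delta> has_vector_derivative ?F' t) (at t within {0..})"
    unfolding dual_energy_def [abs_def]
    by (intro has_vector_derivative_add 1
        bounded_linear.has_vector_derivative[OF bounded_linear_mult_right] 2 3)
  let ?x = "u t" and ?y = "u' t"
  have sym: "inner (G ?y) ?x = inner (G ?x) ?y" "inner ?y (G ?x) = inner (G ?x) ?y"
    "inner ?x (G ?y) = inner (G ?x) ?y" "inner ?x (G ?x) = inner (G ?x) ?x"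
    "inner (A ?x) (G ?x) = inner ?x ?x" "inner (A ?x) (G ?y) = inner ?x ?y"
    "inner ?y (G ?y) = inner (G ?y) ?y" "inner ?y ?x = inner ?x ?y"
    using G_sym[OF uS] A_sym[of ?x "G ?x"] A_sym[of ?x "G ?y"] uS G_in AG by (auto simp: inner_commute)
  have Ar: "A (dual_var \<delta> t) = ?y + \<beta> *\<^sub>R A ?x - \<delta> *\<^sub>R ?x"
    using uS by (simp add: dual_var_def A.add A.diff A.scaleR AG)
  have "?F' t + 2 * \<delta> * dual_energy \<delta> t =
      - 2 * ((1 - \<beta> * \<delta>) * (\<beta> * inner (A ?x) ?x - 2 * \<delta> * inner ?x ?x)
        + \<delta>\<^sup>2 * (\<beta> * inner ?x ?x - 2 * \<delta> * inner (G ?x) ?x))"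
    unfolding dual_energy_def Ar unfolding dual_var_def
    by (simp add: inner_add_left inner_add_right inner_diff_left inner_diff_right sym
        power2_eq_square algebra_simps)
  moreover have "2 * \<delta> * inner ?x ?x \<le> \<beta> * inner (A ?x) ?x"
  proof -
    have "2 * \<delta> * inner ?x ?x \<le> \<beta> * lam * inner ?x ?x"
      using assms by (intro mult_right_mono) auto
    also have "\<dots> \<le> \<beta> * inner (A ?x) ?x"
      using mult_left_mono[OF coercive[OF uS(1)] \<open>\<beta> \<ge> 0\<close>] by simp
    finally show ?thesis .
  qed
  moreover have "2 * \<delta> * inner (G ?x) ?x \<le> \<beta> * inner ?x ?x"
  proof -
    have "2 * \<delta> * inner (G ?x) ?x \<le> \<beta> * lam * inner (G ?x) ?x"
      using assms G_nonneg[OF uS(1)] by (intro mult_right_mono) auto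
    also have "\<dots> \<le> \<beta> * inner ?x ?x"
      using mult_left_mono[OF G_bound[OF uS(1)] \<open>\<beta> \<ge> 0\<close>] by simp
    finally show ?thesis .
  qed
  ultimately show "?F' t \<le> - (2 * \<delta>) * dual_energy \<delta> t"
    using \<open>\<beta> * \<delta> \<le> 1\<close>
    by (smt (verit) mult_nonneg_nonneg zero_le_power2 mult_minus_left)
qed

section \<open>Comparison with the energy, uniformly in \<delta>\<close>

lemma A_sum3_le:
  assumes "x \<in> S" "y \<in> S" "z \<in> S"
  shows "inner (A (x + y + z)) (x + y + z) \<le> 3 * (inner (A x) x + inner (A y) y + inner (A z) z)"
proof -
  \<comment> \<open>These three squares of differences are exactly the gap between the two
    sides.\<close>
  have "0 \<le> inner (A (x - y)) (x - y) + inner (A (y - z)) (y - z) + inner (A (x - z)) (x - z)"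
    using assms by (intro add_nonneg_nonneg A_nonneg in_S)
  moreover have "inner (A (x - y)) (x - y) + inner (A (y - z)) (y - z) + inner (A (x - z)) (x - z)
      = 3 * (inner (A x) x + inner (A y) y + inner (A z) z) - inner (A (x + y + z)) (x + y + z)"
    using A_sym[of y x] A_sym[of z x] A_sym[of z y] assms
    by (simp add: A.add A.diff inner_add_left inner_add_right inner_diff_left inner_diff_right)
  ultimately show ?thesis by simp
qed

lemma inner_sum2_le: "inner (x + y) (x + y) \<le> 2 * inner x x + 2 * inner y (y :: 'b)"
proof -
  have "0 \<le> inner (x - y) (x - y)" by simp
  then show ?thesis
    by (simp add: inner_add_left inner_add_right inner_diff_left inner_diff_right)
qed

context
  fixes \<delta> :: real
  assumes \<alpha>: "\<alpha> \<ge> 0" and \<beta>: "\<beta> \<ge> 0" and \<delta>: "\<delta> > 0"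
    and \<delta>1: "2 * \<delta> \<le> \<alpha> + \<beta> * lam" and \<delta>2: "\<delta> * (\<alpha> + \<beta> * lam) \<le> lam"
begin

text \<open>Both upper bounds on \<delta> enter: 2 \<delta> is at most \<alpha> + \<beta> lam, and
  \<delta> times that sum is at most lam. With coercivity, \<delta>^2 |u|^2 is then absorbed by half
  of |u|_1^2.\<close>

lemma \<delta>_sq: "2 * \<delta>\<^sup>2 \<le> lam"
proof -
  have "\<delta> * (2 * \<delta>) \<le> \<delta> * (\<alpha> + \<beta> * lam)"
    using \<delta>1 \<delta> by (intro mult_left_mono) auto
  then show ?thesis using \<delta>2 by (simp add: power2_eq_square)
qed

lemma \<beta>\<delta>: "\<beta> * \<delta> \<le> 1"
proof -
  have "lam * (\<beta> * \<delta>) \<le> lam * 1"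
    using \<delta>2 mult_nonneg_nonneg[OF \<alpha>, of \<delta>] \<delta> by (simp add: algebra_simps)
  then show ?thesis using lam by (simp only: mult_le_cancel_left_pos)
qed

lemma \<delta>_sq_u: "t \<ge> 0 \<Longrightarrow> 2 * (\<delta>\<^sup>2 * inner (u t) (u t)) \<le> inner (A (u t)) (u t)"
  using mult_right_mono[OF \<delta>_sq, of "inner (u t) (u t)"] coercive[OF u_in, of t] by simp

text \<open>Without its nonpositive parts the functional is at most 2 |u'|^2 + |u|_1^2 + 3
  \<delta>^2 |u|^2. By \<open>\<delta>_sq_u\<close> the last term is at most 3/2 |u|_1^2, whence
  5/2.\<close>

lemma shifted_energy_0_le: "shifted_energy \<delta> 0 \<le> 5/2 * double_energy 0"
proof -
  have "inner (u' 0 + \<delta> *\<^sub>R u 0) (u' 0 + \<delta> *\<^sub>R u 0) \<le> 2 * inner (u' 0) (u' 0) + 2 * (\<delta>\<^sup>2 * inner (u 0) (u 0))"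
    using inner_sum2_le[of "u' 0" "\<delta> *\<^sub>R u 0"] by (simp add: power2_eq_square)
  moreover have "0 \<le> \<beta> * \<delta> * inner (A (u 0)) (u 0)" "0 \<le> \<alpha> * \<delta> * inner (u 0) (u 0)"
    using \<alpha> \<beta> \<delta> A_nonneg[OF u_in] by simp_all
  moreover have "shifted_energy \<delta> 0 = inner (u' 0 + \<delta> *\<^sub>R u 0) (u' 0 + \<delta> *\<^sub>R u 0)
      + inner (A (u 0)) (u 0) - \<beta> * \<delta> * inner (A (u 0)) (u 0)
      + \<delta>\<^sup>2 * inner (u 0) (u 0) - \<alpha> * \<delta> * inner (u 0) (u 0)"
    by (simp add: shifted_energy_def left_diff_distrib)
  ultimately show ?thesis
    using \<delta>_sq_u[OF order_refl] inner_ge_zero[of "u' 0"] unfolding double_energy_def by argo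
qed

lemma shifted_energy_le:
  assumes "t \<ge> 0" shows "shifted_energy \<delta> t \<le> 5/2 * (exp (- (2 * \<delta>) * t) * double_energy 0)"
proof -
  have "exp (- (2 * \<delta>) * t) * shifted_energy \<delta> 0 \<le> exp (- (2 * \<delta>) * t) * (5/2 * double_energy 0)"
    by (intro mult_left_mono shifted_energy_0_le) simp
  then show ?thesis
    using shifted_energy_decay[OF \<delta>1 \<beta> assms] by (simp only: mult.left_commute)
qed

lemma u'_le: "inner (u' t) (u' t) \<le> 2 * inner (u' t + \<delta> *\<^sub>R u t) (u' t + \<delta> *\<^sub>R u t) + 2 * (\<delta>\<^sup>2 * inner (u t) (u t))"
  using inner_sum2_le[of "u' t + \<delta> *\<^sub>R u t" "- \<delta> *\<^sub>R u t"] by (simp add: power2_eq_square)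

text \<open>The number c is a lower bound, uniform in \<delta>, for the share of |u|_1^2 that
  survives in the shifted energy beside |p|^2. Its upper bounds come from the cases \<delta> \<ge>
  \<alpha>, small \<delta>, and \<delta> of medium size.\<close>

lemma double_energy_decay_pos:
  assumes \<alpha>0: "\<alpha> > 0" and t: "t \<ge> 0"
    and c: "0 < c" "c \<le> 1/2" "c \<le> lam / (4 * (\<alpha> + \<beta> * lam)\<^sup>2)" "c \<le> \<alpha> / (\<alpha> + \<beta> * lam)"
  shows "double_energy t \<le> 5 / c * (exp (- (2 * \<delta>) * t) * double_energy 0)"
proof -
  define D where "D = \<alpha> + \<beta> * lam"
  define a where "a = inner (A (u t)) (u t)"
  define n where "n = inner (u t) (u t)"
  define Q where "Q = inner (u' t + \<delta> *\<^sub>R u t) (u' t + \<delta> *\<^sub>R u t)"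
  have D: "D > 0" using \<alpha>0 \<beta> lam by (simp add: D_def add_pos_nonneg)
  have an: "0 \<le> n" "lam * n \<le> a" "0 \<le> a"
    using coercive A_nonneg u_in t by (auto simp: a_def n_def)
  have "c * a \<le> (1 - \<beta> * \<delta>) * a + (\<delta>\<^sup>2 - \<alpha> * \<delta>) * n"
  proof (cases "\<delta> \<ge> \<alpha>")
    case True
    \<comment> \<open>From \<delta> D \<le> lam follows 1 - \<beta> \<delta> \<ge> 1 - \<beta> lam /
      D = \<alpha> / D, which explains the bound c \<le> \<alpha> / D; the |u|^2 term has a
      nonnegative weight in this case.\<close>
    have "D * (\<beta> * \<delta>) \<le> D * (1 - c)"
    proof -
      have "c * D \<le> \<alpha>" using c(4) D by (simp add: D_def[symmetric] field_simps)
      moreover have "\<beta> * (\<delta> * D) \<le> \<beta> * lam"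
        using \<delta>2 \<beta> by (intro mult_left_mono) (simp_all add: D_def)
      ultimately show ?thesis by (simp add: D_def algebra_simps)
    qed
    then have "c \<le> 1 - \<beta> * \<delta>" using D by (simp only: mult_le_cancel_left_pos)
    then have "c * a \<le> (1 - \<beta> * \<delta>) * a" using an(3) by (rule mult_right_mono)
    moreover have "0 \<le> (\<delta>\<^sup>2 - \<alpha> * \<delta>) * n"
      using True \<delta> an(1) by (simp add: power2_eq_square)
    ultimately show ?thesis by simp
  next
    case False
    \<comment> \<open>Either \<delta> D \<le> lam/2, leaving at least half of lam, or \<delta> > lam
      / (2 D), and then \<delta>^2 alone suffices because lam - \<delta> D \<ge> 0.\<close>
    have "lam * c \<le> lam - \<delta> * D + \<delta>\<^sup>2"
    proof (cases "2 * (\<delta> * D) \<le> lam")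
      case True
      have "lam * c \<le> lam * (1/2)" using c(2) lam by (intro mult_left_mono) auto
      then show ?thesis using True zero_le_power2[of \<delta>] by linarith
    next
      case False
      have "lam * c \<le> lam * (lam / (4 * D\<^sup>2))"
        using c(3) lam by (intro mult_left_mono) (auto simp: D_def)
      also have "\<dots> = (lam / (2 * D))\<^sup>2" by (simp add: power2_eq_square)
      also have "\<dots> \<le> \<delta>\<^sup>2"
        using False D lam \<delta> by (intro power_mono) (auto simp: field_simps)
      finally show ?thesis using \<delta>2 by (simp add: D_def)
    qed
    then have "lam * c * a \<le> (lam - \<delta> * D + \<delta>\<^sup>2) * a" using an(3) by (rule mult_right_mono)
    also have "\<dots> = lam * (1 - \<beta> * \<delta>) * a - (\<alpha> * \<delta> - \<delta>\<^sup>2) * a"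
      by (simp add: D_def algebra_simps)
    \<comment> \<open>For \<delta> < \<alpha> the |u|^2 term is subtracted, so coercivity trades it
      against the gradient term.\<close>
    also have "\<dots> \<le> lam * (1 - \<beta> * \<delta>) * a - (\<alpha> * \<delta> - \<delta>\<^sup>2) * (lam * n)"
      using False \<delta> an(2) by (intro diff_left_mono mult_left_mono) (auto simp: power2_eq_square)
    also have "\<dots> = lam * ((1 - \<beta> * \<delta>) * a + (\<delta>\<^sup>2 - \<alpha> * \<delta>) * n)"
      by (simp add: algebra_simps)
    finally have "lam * (c * a) \<le> lam * ((1 - \<beta> * \<delta>) * a + (\<delta>\<^sup>2 - \<alpha> * \<delta>) * n)"
      by (simp add: mult.assoc)
    then show ?thesis using lam by (simp only: mult_le_cancel_left_pos)
  qed
  then have 1: "c * a \<le> shifted_energy \<delta> t - Q"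
    by (simp add: shifted_energy_def a_def n_def Q_def)
  \<comment> \<open>By \<open>u'_le\<close> and \<open>\<delta>_sq_u\<close>, |u'|^2 \<le> 2 Q + a.
    After multiplication by c \<le> 1 the right-hand side is at most twice the shifted energy, and 2
    times 5/2 gives the 5 in 5 / c.\<close>
  have "double_energy t \<le> 2 * (Q + a)"
    using u'_le[of t] \<delta>_sq_u[OF t] by (simp add: double_energy_def a_def Q_def)
  then have "c * double_energy t \<le> 2 * (c * Q + c * a)"
    using mult_left_mono[of "double_energy t" "2 * (Q + a)" c] c(1) by (simp add: algebra_simps)
  moreover have "c * Q \<le> 1 * Q"
    using c(2) by (intro mult_right_mono) (auto simp: Q_def)
  ultimately have "c * double_energy t \<le> 2 * shifted_energy \<delta> t"
    using 1 by simp
  also have "\<dots> \<le> 5 * (exp (- (2 * \<delta>) * t) * double_energy 0)"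
    using shifted_energy_le[OF t] by simp
  finally show ?thesis using c(1) by (simp add: field_simps)
qed

text \<open>The gradient is recovered from \<beta> u = r - G u' + \<delta> G u, each application of
  \<open>G\<close> costing a factor 1/lam. No step divides by 1 - \<beta> \<delta>, so the constant
  is free of \<delta>.\<close>

lemma double_energy_decay_zero:
  assumes \<alpha>0: "\<alpha> = 0" and \<beta>0: "\<beta> > 0" and t: "t \<ge> 0"
  shows "double_energy t \<le> (14 + 63 / (2 * lam * \<beta>\<^sup>2)) * (exp (- (2 * \<delta>) * t) * double_energy 0)"
proof -
  let ?e = "exp (- (2 * \<delta>) * t) * double_energy 0"
  have G_A: "inner (A (G x)) (G x) \<le> inner x x / lam" if "x \<in> S" for x
    using G_bound[OF that] lam AG[OF that] by (simp add: inner_commute field_simps)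
  have "dual_energy \<delta> 0 \<le> (3 * \<beta>\<^sup>2 + 3 / lam) * double_energy 0"
  proof -
    let ?x = "u 0" and ?y = "u' 0"
    have S: "?x \<in> S" "?y \<in> S" using u_in u'_in by auto
    have mem: "G ?y \<in> S" "\<beta> *\<^sub>R ?x \<in> S" "(- \<delta>) *\<^sub>R G ?x \<in> S"
      by (intro in_S G_in S)+
    have "dual_var \<delta> 0 = G ?y + \<beta> *\<^sub>R ?x + (- \<delta>) *\<^sub>R G ?x"
      by (simp add: dual_var_def)
    then have "inner (A (dual_var \<delta> 0)) (dual_var \<delta> 0) \<le> 3 * (inner (A (G ?y)) (G ?y)
        + inner (A (\<beta> *\<^sub>R ?x)) (\<beta> *\<^sub>R ?x) + inner (A ((- \<delta>) *\<^sub>R G ?x)) ((- \<delta>) *\<^sub>R G ?x))"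
      using A_sum3_le[OF mem] by (simp only:)
    also have "\<dots> = 3 * (inner (A (G ?y)) (G ?y) + \<beta>\<^sup>2 * inner (A ?x) ?x + \<delta>\<^sup>2 * inner (A (G ?x)) (G ?x))"
      by (simp add: A.scaleR A.neg power2_eq_square)
    also have "\<dots> \<le> 3 * (inner ?y ?y / lam + \<beta>\<^sup>2 * inner (A ?x) ?x + \<delta>\<^sup>2 * (inner ?x ?x / lam))"
      using S G_A by (intro mult_left_mono add_mono) auto
    finally have 1: "inner (A (dual_var \<delta> 0)) (dual_var \<delta> 0) \<le> \<dots>" .
    have 2: "(1 - \<beta> * \<delta>) * inner ?x ?x \<le> inner (A ?x) ?x / lam"
    proof -
      have "(1 - \<beta> * \<delta>) * inner ?x ?x \<le> 1 * inner ?x ?x"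
        using \<beta> \<delta> by (intro mult_right_mono) auto
      also have "\<dots> \<le> inner (A ?x) ?x / lam"
        using coercive[OF S(1)] lam by (simp add: field_simps)
      finally show ?thesis .
    qed
    have 3: "\<delta>\<^sup>2 * inner (G ?x) ?x \<le> \<delta>\<^sup>2 * (inner ?x ?x / lam)"
      using G_bound[OF S(1)] lam by (intro mult_left_mono) (auto simp: field_simps)
    have 4: "2 * (\<delta>\<^sup>2 * (inner ?x ?x / lam)) \<le> inner (A ?x) ?x / lam"
      using divide_right_mono[OF \<delta>_sq_u[OF order_refl], of lam] lam by simp
    \<comment> \<open>The facts \<open>1\<close> and \<open>3\<close> together contribute 4
      \<delta>^2 |u|^2 / lam, which \<open>4\<close> bounds by 2 |u|_1^2 / lam; \<open>2\<close>
      supplies the third such term.\<close>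
    have "dual_energy \<delta> 0 \<le> 3 * (inner ?y ?y / lam) + 3 * (\<beta>\<^sup>2 * inner (A ?x) ?x)
        + 3 * (inner (A ?x) ?x / lam)"
      unfolding dual_energy_def using 1 2 3 4 by argo
    also have "\<dots> = 3 * \<beta>\<^sup>2 * inner (A ?x) ?x + 3 / lam * double_energy 0"
      by (simp add: double_energy_def add_divide_distrib)
    also have "\<dots> \<le> 3 * \<beta>\<^sup>2 * double_energy 0 + 3 / lam * double_energy 0"
      by (intro add_right_mono mult_left_mono) (auto simp: double_energy_def)
    finally show ?thesis by (simp add: algebra_simps)
  qed
  then have "exp (- (2 * \<delta>) * t) * dual_energy \<delta> 0
      \<le> exp (- (2 * \<delta>) * t) * ((3 * \<beta>\<^sup>2 + 3 / lam) * double_energy 0)"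
    by (intro mult_left_mono) auto
  moreover have "dual_energy \<delta> t \<le> exp (- (2 * \<delta>) * t) * dual_energy \<delta> 0"
    using \<alpha>0 \<delta> \<delta>1 \<beta> \<beta>\<delta> t by (intro dual_energy_decay) auto
  ultimately have F: "dual_energy \<delta> t \<le> (3 * \<beta>\<^sup>2 + 3 / lam) * ?e"
    by (simp only: mult.left_commute)
  let ?x = "u t" and ?y = "u' t" and ?L = "shifted_energy \<delta> t"
  have S: "?x \<in> S" "?y \<in> S" "dual_var \<delta> t \<in> S" using u_in u'_in dual_var_in t by auto
  have nn: "0 \<le> (1 - \<beta> * \<delta>) * inner (A ?x) ?x" "0 \<le> (1 - \<beta> * \<delta>) * inner ?x ?x"
    "0 \<le> \<delta>\<^sup>2 * inner (G ?x) ?x" "0 \<le> \<delta>\<^sup>2 * inner ?x ?x"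
    using \<beta>\<delta> A_nonneg G_nonneg S by simp_all
  \<comment> \<open>With \<alpha> = 0 and \<beta> \<delta> \<le> 1 every term of the shifted energy
    is nonnegative, so it controls u' and \<delta> u even when 1 - \<beta> \<delta>
    vanishes.\<close>
  have L: "inner ?y ?y \<le> 2 * ?L" "\<delta>\<^sup>2 * inner ?x ?x \<le> ?L"
    using u'_le[of t] nn inner_ge_zero[of "?y + \<delta> *\<^sub>R ?x"] \<alpha>0 unfolding shifted_energy_def
    by (simp_all add: inner_add_left)
  have mem: "(- 1) *\<^sub>R G ?y \<in> S" "\<delta> *\<^sub>R G ?x \<in> S"
    by (intro in_S G_in S)+
  have "\<beta> *\<^sub>R ?x = dual_var \<delta> t + (- 1) *\<^sub>R G ?y + \<delta> *\<^sub>R G ?x"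
    by (simp add: dual_var_def)
  then have "inner (A (\<beta> *\<^sub>R ?x)) (\<beta> *\<^sub>R ?x) \<le> 3 * (inner (A (dual_var \<delta> t)) (dual_var \<delta> t)
      + inner (A ((- 1) *\<^sub>R G ?y)) ((- 1) *\<^sub>R G ?y) + inner (A (\<delta> *\<^sub>R G ?x)) (\<delta> *\<^sub>R G ?x))"
    using A_sum3_le[OF S(3) mem] by (simp only:)
  also have "\<dots> = 3 * (inner (A (dual_var \<delta> t)) (dual_var \<delta> t)
      + inner (A (G ?y)) (G ?y) + \<delta>\<^sup>2 * inner (A (G ?x)) (G ?x))"
    by (simp add: A.scaleR A.neg power2_eq_square)
  also have "\<dots> \<le> 3 * (dual_energy \<delta> t + 2 * ?L / lam + ?L / lam)"
  proof -
    have "inner (A (G ?y)) (G ?y) \<le> 2 * ?L / lam"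
      using G_A[OF S(2)] divide_right_mono[OF L(1), of lam] lam by simp
    moreover have "\<delta>\<^sup>2 * inner (A (G ?x)) (G ?x) \<le> ?L / lam"
      using mult_left_mono[OF G_A[OF S(1)], of "\<delta>\<^sup>2"] divide_right_mono[OF L(2), of lam] lam by simp
    ultimately show ?thesis
      using nn unfolding dual_energy_def by simp
  qed
  also have "\<dots> = 3 * dual_energy \<delta> t + 9 * ?L / lam" by (simp add: add_divide_distrib)
  also have "\<dots> \<le> 3 * ((3 * \<beta>\<^sup>2 + 3 / lam) * ?e) + 9 * (5/2 * ?e) / lam"
    using F shifted_energy_le[OF t] lam by (intro add_mono mult_left_mono divide_right_mono) auto
  \<comment> \<open>Here 9 from the dual energy and 9 * 5/2 from the shifted energy add up to 63/2.
    After division by \<beta>^2, the 5 from |u'|^2 turns 9 into 14.\<close>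
  also have "\<dots> = (9 * \<beta>\<^sup>2 + 63 / (2 * lam)) * ?e"
    by (simp add: algebra_simps add_divide_distrib)
  finally have "\<beta>\<^sup>2 * inner (A ?x) ?x \<le> (9 * \<beta>\<^sup>2 + 63 / (2 * lam)) * ?e"
    by (simp add: A.scaleR power2_eq_square)
  then have "inner (A ?x) ?x \<le> (9 + 63 / (2 * lam * \<beta>\<^sup>2)) * ?e"
    using \<beta>0 lam by (simp add: field_simps)
  moreover have "inner ?y ?y \<le> 5 * ?e" using L(1) shifted_energy_le[OF t] by simp
  ultimately show ?thesis by (simp add: double_energy_def algebra_simps)
qed

end

end

section \<open>The semidiscrete problem\<close>

text \<open>The end point 0 is a limit point of the half-line as well, so the one-sided derivative
  in \<open>time_deriv\<close> is unique there too.\<close>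

lemma at_within_atLeast_neq_bot: "t \<ge> 0 \<Longrightarrow> at t within {0..} \<noteq> (bot :: real filter)"
  using islimpt_subset[of t "{t..t + 1}" "{0..}"] by (simp add: trivial_limit_within islimpt_Icc)

lemma time_deriv_eqI:
  "(u has_vector_derivative d) (at t within {0..}) \<Longrightarrow> t \<ge> 0 \<Longrightarrow> time_deriv u t = d"
  unfolding time_deriv_def by (intro vector_derivative_within at_within_atLeast_neq_bot)

lemma has_time_deriv:
  "u differentiable (at t within {0..}) \<Longrightarrow> (u has_vector_derivative time_deriv u t) (at t within {0..})"
  unfolding time_deriv_def by (simp add: vector_derivative_works)

text \<open>Strict positivity is the Poincare inequality on the conforming space; the rest is
  linearity of weak derivatives.\<close>

lemma positive_definite_form_grad_form:
  assumes "dirichlet_setting \<Omega> lam1" "span B \<subseteq> H10 \<Omega>"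
  shows "positive_definite_form (span B) (grad_form \<Omega>)"
proof
  have "open \<Omega>" and lam1: "lam1 > 0"
    and Poincare: "\<And>v. v \<in> H10 \<Omega> \<Longrightarrow> (norm v)\<^sup>2 \<le> inverse lam1 * (H1_seminorm \<Omega> v)\<^sup>2"
    using assms(1) by (auto simp: dirichlet_setting_def)
  have H1: "v \<in> H1 \<Omega>" if "v \<in> span B" for v
    using assms(2) that by (auto simp: H10_def)
  show "subspace (span B)" by simp
  show "grad_form \<Omega> x y = grad_form \<Omega> y x" for x y by (rule grad_form_sym)
  show "grad_form \<Omega> (x + y) z = grad_form \<Omega> x z + grad_form \<Omega> y z"
    if "x \<in> span B" "y \<in> span B" for x y z
    using that H1 \<open>open \<Omega>\<close> by (intro grad_form_add_left)
  show "grad_form \<Omega> (c *\<^sub>R x) y = c * grad_form \<Omega> x y" if "x \<in> span B" for c x y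
    using that H1 \<open>open \<Omega>\<close> by (intro grad_form_scaleR_left)
  show "0 < grad_form \<Omega> x x" if "x \<in> span B" "x \<noteq> 0" for x
  proof -
    have "0 < (norm x)\<^sup>2" using that by simp
    also have "\<dots> \<le> inverse lam1 * grad_form \<Omega> x x"
      using Poincare[of x] that assms(2) by (auto simp: H1_seminorm_power2)
    finally show ?thesis using lam1 by (simp add: zero_less_mult_iff)
  qed
qed

text \<open>The projection P fixes the curve, so its derivative d satisfies d = P d.\<close>

lemma time_deriv_in_span:
  fixes B :: "'b::real_inner set"
  assumes "finite B" and u: "\<And>s. s \<ge> 0 \<Longrightarrow> u s \<in> span B"
    and "u differentiable (at t within {0..})" "t \<ge> 0"
  shows "time_deriv u t \<in> span B"
proof -
  obtain P where P: "bounded_linear P" "\<And>x. P x \<in> span B" "\<And>x. x \<in> span B \<Longrightarrow> P x = x"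
    using finite_span_projection[OF \<open>finite B\<close>] by blast
  have "((\<lambda>s. P (u s)) has_vector_derivative P (time_deriv u t)) (at t within {0..})"
    using assms(3) by (intro bounded_linear.has_vector_derivative[OF P(1)] has_time_deriv)
  then have "(u has_vector_derivative P (time_deriv u t)) (at t within {0..})"
    by (rule has_vector_derivative_transform[rotated 2]) (use assms P u in auto)
  then have "time_deriv u t = P (time_deriv u t)"
    using \<open>t \<ge> 0\<close> by (rule time_deriv_eqI)
  then show ?thesis using P(2) by metis
qed

section \<open>Solutions as curves in the discrete space\<close>

context
  fixes \<Omega> :: "'a::euclidean_space set" and B :: "'a L2 set" and A :: "'a L2 \<Rightarrow> 'a L2"
    and \<alpha> \<beta> :: real
  assumes B: "finite B" and A_bl: "bounded_linear A" and A_in: "\<And>x. A x \<in> span B"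
    and A_form: "\<forall>x\<in>span B. \<forall>y\<in>span B. inner (A x) y = grad_form \<Omega> x y"
begin

lemmas A = A_form[rule_format]

text \<open>The variational equation becomes an operator equation: its residual lies in
  \<open>span B\<close> and may be used as its own test function.\<close>

lemma semidiscrete_solutionD:
  assumes sol: "semidiscrete_solution \<Omega> \<alpha> \<beta> (span B) u0 u1 u" and t: "t \<ge> 0"
  shows "u t \<in> span B" "time_deriv u t \<in> span B"
    "(u has_vector_derivative time_deriv u t) (at t within {0..})"
    "(time_deriv u has_vector_derivative
       - (\<beta> *\<^sub>R A (time_deriv u t) + \<alpha> *\<^sub>R time_deriv u t + A (u t))) (at t within {0..})"
proof -
  note sol = sol[unfolded semidiscrete_solution_def]
  have in1: "time_deriv u s \<in> span B" if "s \<ge> 0" for s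
    using sol that by (intro time_deriv_in_span B) auto
  show "u t \<in> span B" "time_deriv u t \<in> span B"
    "(u has_vector_derivative time_deriv u t) (at t within {0..})"
    using sol t in1 has_time_deriv by auto
  let ?w = "time_deriv (time_deriv u) t + (\<beta> *\<^sub>R A (time_deriv u t) + \<alpha> *\<^sub>R time_deriv u t + A (u t))"
  have "time_deriv (time_deriv u) t \<in> span B"
    using sol t in1 by (intro time_deriv_in_span B) auto
  then have w: "?w \<in> span B"
    using in1[OF t] by (intro span_add span_scale A_in)
  have "inner ?w v = 0" if "v \<in> span B" for v
    using sol t that in1[OF t] by (simp add: inner_add_left A algebra_simps)
  from this[OF w] have "time_deriv (time_deriv u) t
      = - (\<beta> *\<^sub>R A (time_deriv u t) + \<alpha> *\<^sub>R time_deriv u t + A (u t))"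
    by (simp only: inner_eq_zero_iff eq_neg_iff_add_eq_0)
  then show "(time_deriv u has_vector_derivative
       - (\<beta> *\<^sub>R A (time_deriv u t) + \<alpha> *\<^sub>R time_deriv u t + A (u t))) (at t within {0..})"
    using sol t has_time_deriv[of "time_deriv u" t] by metis
qed

text \<open>Only two time derivatives are assumed. The equation expresses u'' through u and u' by
  bounded linear maps, so u'' is differentiable again, and differentiating this identity yields the
  same equation for u'.\<close>

lemma semidiscrete_solution_time_deriv:
  assumes sol: "semidiscrete_solution \<Omega> \<alpha> \<beta> (span B) u0 u1 u"
  shows "semidiscrete_solution \<Omega> \<alpha> \<beta> (span B) u1 (time_deriv (time_deriv u) 0) (time_deriv u)"
proof -
  note D = semidiscrete_solutionD[OF sol]
  let ?rhs = "\<lambda>v v' :: 'a L2. - (\<beta> *\<^sub>R A v' + \<alpha> *\<^sub>R v' + A v)"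
  have u2: "time_deriv (time_deriv u) t = ?rhs (u t) (time_deriv u t)" if "t \<ge> 0" for t
    using D(4)[OF that] that by (rule time_deriv_eqI)
  have in2: "time_deriv (time_deriv u) t \<in> span B" if "t \<ge> 0" for t
    unfolding u2[OF that] using D(2)[OF that] by (intro span_neg span_add span_scale A_in)
  have "((\<lambda>t. ?rhs (u t) (time_deriv u t)) has_vector_derivative
      ?rhs (time_deriv u t) (?rhs (u t) (time_deriv u t))) (at t within {0..})" if "t \<ge> 0" for t
    by (intro has_vector_derivative_minus has_vector_derivative_add
        bounded_linear.has_vector_derivative[OF bounded_linear_scaleR_right]
        bounded_linear.has_vector_derivative[OF A_bl] D that)
  then have "(time_deriv (time_deriv u) has_vector_derivative
      ?rhs (time_deriv u t) (?rhs (u t) (time_deriv u t))) (at t within {0..})" if "t \<ge> 0" for t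
    by (rule has_vector_derivative_transform[rotated 2]) (use that u2 in auto)
  then have *: "(time_deriv (time_deriv u) has_vector_derivative
      ?rhs (time_deriv u t) (time_deriv (time_deriv u) t)) (at t within {0..})" if "t \<ge> 0" for t
    using that by (simp only: u2)
  then have u3: "time_deriv (time_deriv (time_deriv u)) t
      = ?rhs (time_deriv u t) (time_deriv (time_deriv u) t)" if "t \<ge> 0" for t
    using that by (intro time_deriv_eqI)
  show ?thesis
    unfolding semidiscrete_solution_def
  proof (intro conjI allI impI ballI)
    fix t :: real assume t: "0 \<le> t"
    show "time_deriv u t \<in> span B" by (rule D(2)[OF t])
    show "time_deriv u differentiable at t within {0..}"
      using D(4)[OF t] by (rule differentiableI_vector)
    show "time_deriv (time_deriv u) differentiable at t within {0..}"
      using *[OF t] by (rule differentiableI_vector)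
    fix v assume v: "v \<in> span B"
    show "inner (time_deriv (time_deriv (time_deriv u)) t) v
        + \<beta> * grad_form \<Omega> (time_deriv (time_deriv u) t) v
        + \<alpha> * inner (time_deriv (time_deriv u) t) v + grad_form \<Omega> (time_deriv u t) v = 0"
      unfolding u3[OF t] A[OF in2[OF t] v, symmetric] A[OF D(2)[OF t] v, symmetric]
      by (simp add: inner_add_left inner_diff_left)
  qed (use sol in \<open>auto simp: semidiscrete_solution_def\<close>)
qed

lemma semidiscrete_solution_funpow_time_deriv:
  "semidiscrete_solution \<Omega> \<alpha> \<beta> (span B) u0 u1 u \<Longrightarrow>
    \<exists>v0 v1. semidiscrete_solution \<Omega> \<alpha> \<beta> (span B) v0 v1 ((time_deriv ^^ n) u)"
proof (induction n)
  case (Suc n)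
  then obtain v0 v1 where "semidiscrete_solution \<Omega> \<alpha> \<beta> (span B) v0 v1 ((time_deriv ^^ n) u)"
    by blast
  from semidiscrete_solution_time_deriv[OF this] show ?case
    unfolding funpow.simps o_apply by (intro exI)
qed auto

end

text \<open>The derivative of order k - 1 is itself a solution, and its first-order energy is the
  energy of order k of u.\<close>

lemma damped_wave_semidiscrete:
  assumes "dirichlet_setting \<Omega> lam1" "finite B" "span B \<subseteq> H10 \<Omega>"
    and sol: "semidiscrete_solution \<Omega> \<alpha> \<beta> (span B) u0 u1 u" and "k \<ge> 1"
  obtains A G where
    "damped_wave (span B) A G \<alpha> \<beta> lam1 ((time_deriv ^^ (k - 1)) u) ((time_deriv ^^ k) u)"
    "\<And>t. t \<ge> 0 \<Longrightarrow> energy \<Omega> k u t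
       = damped_wave.double_energy A ((time_deriv ^^ (k - 1)) u) ((time_deriv ^^ k) u) t / 2"
proof -
  note form = positive_definite_form_grad_form[OF assms(1,3)]
  obtain A where A: "bounded_linear A" "\<And>x. A x \<in> span B"
    "\<And>x y. x \<in> span B \<Longrightarrow> y \<in> span B \<Longrightarrow> inner (A x) y = grad_form \<Omega> x y"
    using form_operator[OF assms(2) form] by blast
  obtain G where G: "bounded_linear G" "\<And>x. G x \<in> span B"
    "\<And>x y. y \<in> span B \<Longrightarrow> grad_form \<Omega> (G x) y = inner x y"
    using form_inverse_operator[OF assms(2) form] by blast
  obtain w where w: "w = (time_deriv ^^ (k - 1)) u" by blast
  \<comment> \<open>Subtraction on naturals truncates; k \<ge> 1 makes k the successor of k -
    1.\<close>
  have w': "(time_deriv ^^ k) u = time_deriv w"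
    using \<open>k \<ge> 1\<close> by (cases k) (simp_all add: w)
  have A_form: "\<forall>x\<in>span B. \<forall>y\<in>span B. inner (A x) y = grad_form \<Omega> x y"
    using A(3) by blast
  obtain v0 v1 where "semidiscrete_solution \<Omega> \<alpha> \<beta> (span B) v0 v1 w"
    using semidiscrete_solution_funpow_time_deriv[OF assms(2) A(1,2) A_form sol] w by blast
  note D = semidiscrete_solutionD[OF assms(2) A(1,2) A_form this]
  have wave: "damped_wave (span B) A G \<alpha> \<beta> lam1 w (time_deriv w)"
  proof (rule damped_wave.intro)
    show "inner (A x) y = inner (A y) x" if "x \<in> span B" "y \<in> span B" for x y
      using that by (simp add: A(3) grad_form_sym)
    show "A (G x) = x" if x: "x \<in> span B" for x
    proof -
      \<comment> \<open>The difference lies in \<open>span B\<close> and is orthogonal to that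
        space, hence to itself.\<close>
      have "A (G x) - x \<in> span B" using A(2) x by (rule span_diff)
      then have "inner (A (G x) - x) (A (G x) - x) = 0"
        by (subst inner_diff_left) (simp add: A(3) G(2,3))
      then show ?thesis by simp
    qed
    show "lam1 * inner x x \<le> inner (A x) x" if "x \<in> span B" for x
    proof -
      have "(norm x)\<^sup>2 \<le> inverse lam1 * (H1_seminorm \<Omega> x)\<^sup>2" "lam1 > 0"
        using assms(1,3) that by (auto simp: dirichlet_setting_def)
      then show ?thesis
        using that by (simp add: A(3) H1_seminorm_power2 power2_norm_eq_inner field_simps)
    qed
    show "lam1 > 0" using assms(1) by (simp add: dirichlet_setting_def)
  qed (use A G D subspace_span in auto)
  then interpret damped_wave "span B" A G \<alpha> \<beta> lam1 w "time_deriv w" .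
  have "energy \<Omega> k u t = double_energy t / 2" if "t \<ge> 0" for t
    unfolding energy_def double_energy_def w' w[symmetric] using D(1)[OF that]
    by (simp add: A(3) H1_seminorm_power2 power2_norm_eq_inner)
  with wave show ?thesis
    using that unfolding w' w[symmetric] by blast
qed

section \<open>Choice of the constant and conclusion\<close>

lemma energy_decay:
  fixes \<alpha> \<beta> lam1 :: real
  assumes "(\<alpha> > 0 \<and> \<beta> \<ge> 0) \<or> (\<alpha> \<ge> 0 \<and> \<beta> > 0)"
  obtains C where "C > 0" and "\<And>(\<Omega> :: 'a::euclidean_space set) H T X \<delta> k h u0 u1 u t.
      dirichlet_setting \<Omega> lam1 \<Longrightarrow> finite_element_spaces \<Omega> H T X \<Longrightarrow> 0 < \<delta> \<Longrightarrow>
      \<delta> \<le> min ((\<alpha> + \<beta> * lam1) / 2) (lam1 / (\<alpha> + \<beta> * lam1)) \<Longrightarrow> k \<ge> 1 \<Longrightarrow> h \<in> H \<Longrightarrow>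
      semidiscrete_solution \<Omega> \<alpha> \<beta> (X h) u0 u1 u \<Longrightarrow> t \<ge> 0 \<Longrightarrow>
      energy \<Omega> k u t \<le> C * exp (- 2 * \<delta> * t) * energy \<Omega> k u 0"
proof (cases "lam1 > 0")
  case False
  \<comment> \<open>No domain satisfies \<open>dirichlet_setting\<close> with a nonpositive lam1, so
    any positive constant will do.\<close>
  then show ?thesis
    by (intro that[of 1]) (simp_all add: dirichlet_setting_def)
next
  case True
  define D where "D = \<alpha> + \<beta> * lam1"
  have D: "D > 0" using assms True by (auto simp: D_def add_pos_nonneg add_nonneg_pos)
  \<comment> \<open>The largest c allowed by \<open>double_energy_decay_pos\<close>. It is positive
    only for \<alpha> > 0, hence the case distinction in \<open>C\<close>; both constants are fixed
    before \<Omega>, the mesh, \<delta> and k.\<close>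
  define c where "c = min (1/2) (min (lam1 / (4 * D\<^sup>2)) (\<alpha> / D))"
  define C where "C = (if \<alpha> > 0 then 5 / c else 14 + 63 / (2 * lam1 * \<beta>\<^sup>2))"
  have c_pos: "c > 0" if "\<alpha> > 0"
    using that D True by (simp add: c_def)
  have c_le: "c \<le> 1/2" "c \<le> lam1 / (4 * D\<^sup>2)" "c \<le> \<alpha> / D"
    unfolding c_def by (simp_all only: min_le_iff_disj order_refl simp_thms)
  have "C > 0" using c_pos True by (auto simp: C_def intro!: add_pos_nonneg)
  then show ?thesis
  proof (rule that)
    show "energy \<Omega> k u t \<le> C * exp (- 2 * \<delta> * t) * energy \<Omega> k u 0"
      if dir: "dirichlet_setting \<Omega> lam1" and fe: "finite_element_spaces \<Omega> H T X"
      and \<delta>: "0 < \<delta>" "\<delta> \<le> min ((\<alpha> + \<beta> * lam1) / 2) (lam1 / (\<alpha> + \<beta> * lam1))" and "k \<ge> 1" "h \<in> H"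
      and sol: "semidiscrete_solution \<Omega> \<alpha> \<beta> (X h) u0 u1 u" and "t \<ge> 0"
    for \<Omega> :: "'a set" and H T X \<delta> k h u0 u1 u t
  proof -
    obtain B where B: "finite B" "X h = span B" "span B \<subseteq> H10 \<Omega>"
      using fe \<open>h \<in> H\<close> unfolding finite_element_spaces_def by metis
    obtain A G where wave: "damped_wave (span B) A G \<alpha> \<beta> lam1 ((time_deriv ^^ (k - 1)) u) ((time_deriv ^^ k) u)"
      and double_energy: "\<And>t. t \<ge> 0 \<Longrightarrow> energy \<Omega> k u t
        = damped_wave.double_energy A ((time_deriv ^^ (k - 1)) u) ((time_deriv ^^ k) u) t / 2"
      using damped_wave_semidiscrete[OF dir B(1,3) sol[unfolded B(2)] \<open>k \<ge> 1\<close>] by blast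
    interpret damped_wave "span B" A G \<alpha> \<beta> lam1 "(time_deriv ^^ (k - 1)) u" "(time_deriv ^^ k) u"
      by (rule wave)
    have \<delta>': "2 * \<delta> \<le> \<alpha> + \<beta> * lam1" "\<delta> * (\<alpha> + \<beta> * lam1) \<le> lam1"
      using \<delta>(2) D by (auto simp: D_def[symmetric] field_simps)
    have ab: "\<alpha> \<ge> 0" "\<beta> \<ge> 0" "\<alpha> > 0 \<or> \<alpha> = 0 \<and> \<beta> > 0" using assms by auto
    have "double_energy t \<le> C * (exp (- (2 * \<delta>) * t) * double_energy 0)"
    proof (cases "\<alpha> > 0")
      case True
      then show ?thesis
        using double_energy_decay_pos[OF ab(1,2) \<delta>(1) \<delta>' True \<open>t \<ge> 0\<close> c_pos[OF True] c_le[unfolded D_def]]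
        by (simp add: C_def)
    next
      case False
      then show ?thesis
        using double_energy_decay_zero[OF ab(1,2) \<delta>(1) \<delta>' _ _ \<open>t \<ge> 0\<close>] ab(3) by (simp add: C_def)
    qed
    then show ?thesis
      unfolding double_energy[OF \<open>t \<ge> 0\<close>] double_energy[OF order_refl] by (simp add: mult.assoc)
  qed
  qed
qed

theorem theorem3p2:
  fixes \<alpha> \<beta> lam1 :: real
  assumes "(\<alpha> > 0 \<and> \<beta> \<ge> 0) \<or> (\<alpha> \<ge> 0 \<and> \<beta> > 0)"
  shows "(\<exists>C>0. \<forall>(\<Omega> :: 'a::euclidean_space set) H T X \<delta> (k::nat).
            dirichlet_setting \<Omega> lam1 \<longrightarrow>
            finite_element_spaces \<Omega> H T X \<longrightarrow>
            0 < \<delta> \<longrightarrow> \<delta> \<le> min ((\<alpha> + \<beta> * lam1) / 2) (lam1 / (\<alpha> + \<beta> * lam1)) \<longrightarrow>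
            k \<ge> 1 \<longrightarrow>
            \<delta> < min ((\<alpha> + \<beta> * lam1) / 2) (lam1 / (\<alpha> + \<beta> * lam1)) \<or> \<delta> = (\<alpha> + \<beta> * lam1) / 2 \<longrightarrow>
            (\<forall>h\<in>H. \<forall>u0\<in>X h. \<forall>u1\<in>X h. \<forall>u.
               semidiscrete_solution \<Omega> \<alpha> \<beta> (X h) u0 u1 u \<longrightarrow>
               (\<forall>t\<ge>0. energy \<Omega> k u t \<le> C * exp (- 2 * \<delta> * t) * energy \<Omega> k u 0)))
       \<and> (\<forall>(\<Omega> :: 'a set) H T X \<delta> (k::nat).
            dirichlet_setting \<Omega> lam1 \<longrightarrow>
            finite_element_spaces \<Omega> H T X \<longrightarrow>
            0 < \<delta> \<longrightarrow> \<delta> \<le> min ((\<alpha> + \<beta> * lam1) / 2) (lam1 / (\<alpha> + \<beta> * lam1)) \<longrightarrow>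
            k \<ge> 1 \<longrightarrow>
            \<delta> = lam1 / (\<alpha> + \<beta> * lam1) \<longrightarrow>
            (\<exists>C>0. \<forall>h\<in>H. \<forall>u0\<in>X h. \<forall>u1\<in>X h. \<forall>u.
               semidiscrete_solution \<Omega> \<alpha> \<beta> (X h) u0 u1 u \<longrightarrow>
               (\<forall>t\<ge>0. (norm ((time_deriv ^^ k) u t))\<^sup>2
                        \<le> C * exp (- 2 * \<delta> * t) * energy \<Omega> k u 0)))"
proof -
  obtain C where "C > 0" and C: "\<And>(\<Omega> :: 'a set) H T X \<delta> k h u0 u1 u t.
      dirichlet_setting \<Omega> lam1 \<Longrightarrow> finite_element_spaces \<Omega> H T X \<Longrightarrow> 0 < \<delta> \<Longrightarrow>
      \<delta> \<le> min ((\<alpha> + \<beta> * lam1) / 2) (lam1 / (\<alpha> + \<beta> * lam1)) \<Longrightarrow> k \<ge> 1 \<Longrightarrow> h \<in> H \<Longrightarrow>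
      semidiscrete_solution \<Omega> \<alpha> \<beta> (X h) u0 u1 u \<Longrightarrow> t \<ge> 0 \<Longrightarrow>
      energy \<Omega> k u t \<le> C * exp (- 2 * \<delta> * t) * energy \<Omega> k u 0"
    by (rule energy_decay[OF assms, of lam1]) (rule that)
  have norm_le: "(norm ((time_deriv ^^ k) u t))\<^sup>2 \<le> 2 * energy \<Omega> k u t"
    for \<Omega> :: "'a set" and k u t
    by (simp add: energy_def)
  show ?thesis
  \<comment> \<open>One witness serves both parts: (ii) needs the factor 2 because |u^(k)|^2 is at
    most twice the energy, and (i) tolerates it because the right-hand side is nonnegative.\<close>
  proof (intro conjI exI[of _ "2 * C"] allI impI ballI)
    fix \<Omega> :: "'a set" and H T X \<delta> and k :: nat and h u0 u1 u and t :: real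
    assume *: "dirichlet_setting \<Omega> lam1" "finite_element_spaces \<Omega> H T X" "0 < \<delta>"
      "\<delta> \<le> min ((\<alpha> + \<beta> * lam1) / 2) (lam1 / (\<alpha> + \<beta> * lam1))" "k \<ge> 1"
      "h \<in> H" "semidiscrete_solution \<Omega> \<alpha> \<beta> (X h) u0 u1 u" "t \<ge> 0"
    have "0 \<le> C * exp (- 2 * \<delta> * t) * energy \<Omega> k u 0"
      using \<open>C > 0\<close> by (simp add: energy_def)
    then show "energy \<Omega> k u t \<le> 2 * C * exp (- 2 * \<delta> * t) * energy \<Omega> k u 0"
      using C[OF *] by simp
    show "(norm ((time_deriv ^^ k) u t))\<^sup>2 \<le> 2 * C * exp (- 2 * \<delta> * t) * energy \<Omega> k u 0"
      using C[OF *] norm_le[of k u t \<Omega>] by simp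
  qed (use \<open>C > 0\<close> in auto)
qed

end
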